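(* Let $f\colon M^2\to\mathbf{R}^3$ be a front and $p\in M^2$ a cuspidal edge. Then $p$ is generic if and only if the osculating plane of the singular curve (more precisely, of its image $\hat\gamma=f\circ\gamma$) does not coincide with the limiting tangent plane at $p$. Moreover, if $p$ is a generic cuspidal edge, the Gaussian curvature is unbounded near $p$ and changes sign between the two sides of the cuspidal edge.
   Context: All objects are $C^\infty$; $M^2$ is an oriented $2$-manifold and $\mathbf{R}^3$ carries the Euclidean metric $g_0$. A smooth map $f\colon M^2\to\mathbf{R}^3$ is a front if there is a unit vector field $\nu$ along $f$ with $g_0(f_*X,\nu)=0$ for all $X\in TM^2$ and such that $(f,\nu)\colon M^2\to\mathbf{R}^3\times S^2$ is an immersion. Singular points are the points where $f$ is not an immersion. A cuspidal edge is a singular point at which $f$ is locally diffeomorphic (by diffeomorphism germs of source and target) to $(u,v)\mapsto(u^2,u^3,v)$ at $(0,0)$; near it the singular set is a regular curve $\gamma$ in $M^2$ (the singular curve), and $\hat\gamma=f\circ\gamma$ is a regular space curve. The limiting tangent plane at $p$ is the plane through $f(p)$ perpendicular to $\nu(p)$. The second fundamental form is $h(X,Y)=-g_0(f_*X,D_Y\nu)$, with $D$ the flat connection. A cuspidal edge $p$ is generic if $h$ does not vanish at $p$. The osculating plane of $\hat\gamma$ at $p$ is spanned by $\hat\gamma'$ and $\hat\gamma''$; it is understood to coincide with the limiting tangent plane when $\hat\gamma''$ lies in $\nu(p)^\perp$ (including the case when $\hat\gamma',\hat\gamma''$ are linearly dependent). The Gaussian curvature is that of $f^*g_0$ on the regular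 points. *)

theory Defs
  imports "HOL-Analysis.Analysis"
begin

section \<open>Smooth maps between Euclidean spaces\<close>

text \<open>Intended for open \<open>S\<close>.  For finite-dimensional domains, having all iterated directional
  derivatives in this sense is the usual notion of class \<open>C\<close>-infinity.\<close>

primrec times_differentiable_on ::
  "nat \<Rightarrow> 'a::real_normed_vector set \<Rightarrow> ('a \<Rightarrow> 'b::real_normed_vector) \<Rightarrow> bool" where
  "times_differentiable_on 0 S f \<longleftrightarrow> continuous_on S f"
| "times_differentiable_on (Suc n) S f \<longleftrightarrow>
     (\<forall>x\<in>S. f differentiable (at x)) \<and>
     (\<forall>v. times_differentiable_on n S (\<lambda>x. frechet_derivative f (at x) v))"

definition smooth_on :: "'a::real_normed_vector set \<Rightarrow> ('a \<Rightarrow> 'b::real_normed_vector) \<Rightarrow> bool" where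
  "smooth_on S f \<longleftrightarrow> (\<forall>n. times_differentiable_on n S f)"

definition open_embedding :: "'a::topological_space set \<Rightarrow> ('a \<Rightarrow> 'b::topological_space) \<Rightarrow> bool" where
  "open_embedding U \<phi> \<longleftrightarrow>
     open U \<and> open (\<phi> ` U) \<and> homeomorphism U (\<phi> ` U) \<phi> (inv_into U \<phi>)"

definition euclidean_diffeo :: "'a::real_normed_vector set \<Rightarrow> ('a \<Rightarrow> 'b::real_normed_vector) \<Rightarrow> bool" where
  "euclidean_diffeo W \<beta> \<longleftrightarrow>
     open_embedding W \<beta> \<and> smooth_on W \<beta> \<and> smooth_on (\<beta> ` W) (inv_into W \<beta>)"

section \<open>Oriented smooth surfaces\<close>

text \<open>The surface is the whole type \<open>'m\<close>, whose topology is Hausdorff and second countable by its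
  type classes; its smooth structure and orientation are given by an atlas, which need not be
  maximal.\<close>

type_synonym 'm chart = "'m set \<times> ('m \<Rightarrow> real^2)"

definition oriented_atlas :: "'m::{t2_space,second_countable_topology} chart set \<Rightarrow> bool" where
  "oriented_atlas A \<longleftrightarrow>
     (\<Union>(U,\<phi>)\<in>A. U) = UNIV \<and>
     (\<forall>(U,\<phi>)\<in>A. open_embedding U \<phi>) \<and>
     (\<forall>(U,\<phi>)\<in>A. \<forall>(V,\<psi>)\<in>A.
        smooth_on (\<phi> ` (U \<inter> V)) (\<psi> \<circ> inv_into U \<phi>) \<and>
        (\<forall>x\<in>\<phi> ` (U \<inter> V). det (jacobian (\<psi> \<circ> inv_into U \<phi>) (at x)) > 0))"

definition smooth_map :: "'m chart set \<Rightarrow> ('m \<Rightarrow> 'b::real_normed_vector) \<Rightarrow> bool" where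
  "smooth_map A g \<longleftrightarrow> (\<forall>(U,\<phi>)\<in>A. smooth_on (\<phi> ` U) (g \<circ> inv_into U \<phi>))"

text \<open>Diffeomorphisms from an open subset \<open>V\<close> of the surface onto an open subset of the plane;
  they need not preserve the orientation.\<close>

definition surface_diffeo ::
  "'m::{t2_space,second_countable_topology} chart set \<Rightarrow> 'm set \<Rightarrow> ('m \<Rightarrow> real^2) \<Rightarrow> bool" where
  "surface_diffeo A V \<alpha> \<longleftrightarrow>
     open_embedding V \<alpha> \<and>
     (\<forall>(U,\<phi>)\<in>A. smooth_on (\<phi> ` (U \<inter> V)) (\<alpha> \<circ> inv_into U \<phi>) \<and>
                smooth_on (\<alpha> ` (U \<inter> V)) (\<phi> \<circ> inv_into V \<alpha>))"

text \<open>A tangent vector at \<open>p\<close> is represented by its components \<open>X\<close> in a chart around \<open>p\<close>.  Then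
  \<open>push c g p X\<close> is the derivative of \<open>g\<close> at \<open>p\<close> in direction \<open>X\<close>: it is \<open>g\<^sub>*X\<close>, and, for a
  vector field \<open>g\<close> along a map into Euclidean space, it is \<open>D\<^sub>X g\<close>.\<close>

definition push :: "'m chart \<Rightarrow> ('m \<Rightarrow> 'b::real_normed_vector) \<Rightarrow> 'm \<Rightarrow> real^2 \<Rightarrow> 'b" where
  "push c g p X = frechet_derivative (g \<circ> inv_into (fst c) (snd c)) (at (snd c p)) X"

definition immersion_at :: "'m chart set \<Rightarrow> ('m \<Rightarrow> 'b::real_normed_vector) \<Rightarrow> 'm \<Rightarrow> bool" where
  "immersion_at A g p \<longleftrightarrow> (\<forall>c\<in>A. p \<in> fst c \<longrightarrow> inj (push c g p))"

section \<open>Fronts and cuspidal edges\<close>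

text \<open>\<open>f\<close> is a front with unit normal field \<open>\<nu>\<close>.  Since the unit sphere is a submanifold of
  3-space, \<open>(f, \<nu>)\<close> may be regarded as a map into \<open>R\<^sup>3 \<times> R\<^sup>3\<close>.\<close>

definition front :: "'m chart set \<Rightarrow> ('m \<Rightarrow> real^3) \<Rightarrow> ('m \<Rightarrow> real^3) \<Rightarrow> bool" where
  "front A f \<nu> \<longleftrightarrow>
     smooth_map A f \<and> smooth_map A \<nu> \<and>
     (\<forall>p. norm (\<nu> p) = 1) \<and>
     (\<forall>c\<in>A. \<forall>p\<in>fst c. \<forall>X. push c f p X \<bullet> \<nu> p = 0) \<and>
     (\<forall>p. immersion_at A (\<lambda>q. (f q, \<nu> q)) p)"

definition singular_set :: "'m chart set \<Rightarrow> ('m \<Rightarrow> real^3) \<Rightarrow> 'm set" where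
  "singular_set A f = {p. \<not> immersion_at A f p}"

definition standard_cuspidal_edge :: "real^2 \<Rightarrow> real^3" where
  "standard_cuspidal_edge x = vector [(x$1)^2, (x$1)^3, x$2]"

definition cuspidal_edge ::
  "'m::{t2_space,second_countable_topology} chart set \<Rightarrow> ('m \<Rightarrow> real^3) \<Rightarrow> 'm \<Rightarrow> bool" where
  "cuspidal_edge A f p \<longleftrightarrow>
     p \<in> singular_set A f \<and>
     (\<exists>V \<alpha> W \<beta>.
        p \<in> V \<and> surface_diffeo A V \<alpha> \<and> \<alpha> p = 0 \<and>
        f ` V \<subseteq> W \<and> euclidean_diffeo W (\<beta> :: real^3 \<Rightarrow> real^3) \<and> \<beta> (f p) = 0 \<and>
        (\<forall>q\<in>V. \<beta> (f q) = standard_cuspidal_edge (\<alpha> q)))"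

definition regular_curve ::
  "'m::{t2_space,second_countable_topology} chart set \<Rightarrow> real set \<Rightarrow> (real \<Rightarrow> 'm) \<Rightarrow> bool" where
  "regular_curve A I \<gamma> \<longleftrightarrow>
     continuous_on I \<gamma> \<and>
     (\<forall>(U,\<phi>)\<in>A. smooth_on {t\<in>I. \<gamma> t \<in> U} (\<phi> \<circ> \<gamma>) \<and>
        (\<forall>t\<in>I. \<gamma> t \<in> U \<longrightarrow> vector_derivative (\<phi> \<circ> \<gamma>) (at t) \<noteq> 0))"

text \<open>\<open>\<gamma>\<close> parametrizes the singular set near \<open>p = \<gamma> t\<close>.\<close>

definition singular_curve ::
  "'m::{t2_space,second_countable_topology} chart set \<Rightarrow> ('m \<Rightarrow> real^3) \<Rightarrow> 'm \<Rightarrow>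
   (real \<Rightarrow> 'm) \<Rightarrow> real \<Rightarrow> bool" where
  "singular_curve A f p \<gamma> t \<longleftrightarrow>
     \<gamma> t = p \<and>
     (\<exists>e>0. regular_curve A {t-e<..<t+e} \<gamma> \<and>
        (\<exists>U. open U \<and> p \<in> U \<and> U \<inter> singular_set A f = \<gamma> ` {t-e<..<t+e}))"

definition second_fundamental_form ::
  "'m chart \<Rightarrow> ('m \<Rightarrow> real^3) \<Rightarrow> ('m \<Rightarrow> real^3) \<Rightarrow> 'm \<Rightarrow> real^2 \<Rightarrow> real^2 \<Rightarrow> real" where
  "second_fundamental_form c f \<nu> p X Y = - (push c f p X \<bullet> push c \<nu> p Y)"

definition generic ::
  "'m chart set \<Rightarrow> ('m \<Rightarrow> real^3) \<Rightarrow> ('m \<Rightarrow> real^3) \<Rightarrow> 'm \<Rightarrow> bool" where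
  "generic A f \<nu> p \<longleftrightarrow>
     (\<exists>c\<in>A. p \<in> fst c \<and> (\<exists>X Y. second_fundamental_form c f \<nu> p X Y \<noteq> 0))"

definition limiting_tangent_plane ::
  "('m \<Rightarrow> real^3) \<Rightarrow> ('m \<Rightarrow> real^3) \<Rightarrow> 'm \<Rightarrow> (real^3) set" where
  "limiting_tangent_plane f \<nu> p = {x. (x - f p) \<bullet> \<nu> p = 0}"

text \<open>The osculating plane at \<open>t\<close> of a space curve \<open>c\<close>.  When \<open>c'\<close> and \<open>c''\<close> are linearly dependent
  they span no plane, and by convention the osculating plane is then the given plane \<open>P\<close>, which
  will be the limiting tangent plane.  If they are independent and \<open>c''\<close> is orthogonal
  to \<open>\<nu>\<close>, their span is the limiting tangent plane without any convention.
  (Collinearity with 0 also covers the case \<open>c' = c''\<close>, where \<open>dependent {c', c''}\<close> would not.)\<close>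

definition osculating_plane :: "(real \<Rightarrow> real^3) \<Rightarrow> real \<Rightarrow> (real^3) set \<Rightarrow> (real^3) set" where
  "osculating_plane c t P =
     (let c1 = vector_derivative c (at t);
          c2 = vector_derivative (\<lambda>s. vector_derivative c (at s)) (at t)
      in if collinear {0, c1, c2} then P else (+) (c t) ` span {c1, c2})"

section \<open>Gaussian curvature of the induced metric\<close>

definition partial :: "2 \<Rightarrow> (real^2 \<Rightarrow> 'b::real_normed_vector) \<Rightarrow> real^2 \<Rightarrow> 'b" where
  "partial i F x = frechet_derivative F (at x) (axis i 1)"

text \<open>Curvature of a Riemannian metric \<open>g\<close> on a plane domain: Christoffel symbols of the second kind
  \<open>christoffel g k i j = \<Gamma>\<^sup>k\<^sub>i\<^sub>j\<close>, the curvature tensor in the convention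
  \<open>R(\<partial>\<^sub>i, \<partial>\<^sub>j)\<partial>\<^sub>k = (\<nabla>\<^sub>i \<nabla>\<^sub>j - \<nabla>\<^sub>j \<nabla>\<^sub>i)\<partial>\<^sub>k = \<Sum>\<^sub>l (riemann g l k i j) \<partial>\<^sub>l\<close>, and the sectional
  curvature \<open>g(R(\<partial>\<^sub>1, \<partial>\<^sub>2)\<partial>\<^sub>2, \<partial>\<^sub>1) / det g\<close>, which is 1 for the round unit sphere.\<close>

definition christoffel :: "(real^2 \<Rightarrow> real^2^2) \<Rightarrow> 2 \<Rightarrow> 2 \<Rightarrow> 2 \<Rightarrow> real^2 \<Rightarrow> real" where
  "christoffel g k i j x =
     (1/2) * (\<Sum>l\<in>UNIV. matrix_inv (g x) $ k $ l *
       (partial i (\<lambda>y. g y $ j $ l) x + partial j (\<lambda>y. g y $ i $ l) x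
        - partial l (\<lambda>y. g y $ i $ j) x))"

definition riemann :: "(real^2 \<Rightarrow> real^2^2) \<Rightarrow> 2 \<Rightarrow> 2 \<Rightarrow> 2 \<Rightarrow> 2 \<Rightarrow> real^2 \<Rightarrow> real" where
  "riemann g l k i j x =
     partial i (christoffel g l j k) x - partial j (christoffel g l i k) x
     + (\<Sum>m\<in>UNIV. christoffel g l i m x * christoffel g m j k x
                  - christoffel g l j m x * christoffel g m i k x)"

definition metric_curvature :: "(real^2 \<Rightarrow> real^2^2) \<Rightarrow> real^2 \<Rightarrow> real" where
  "metric_curvature g x = (\<Sum>l\<in>UNIV. riemann g l 2 1 2 x * g x $ l $ 1) / det (g x)"

text \<open>Components of the pullback of the Euclidean metric under \<open>f\<close> in the chart \<open>c\<close>.\<close>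

definition pullback_metric :: "'m chart \<Rightarrow> ('m \<Rightarrow> real^3) \<Rightarrow> real^2 \<Rightarrow> real^2^2" where
  "pullback_metric c f x =
     (\<chi> i j. partial i (f \<circ> inv_into (fst c) (snd c)) x \<bullet> partial j (f \<circ> inv_into (fst c) (snd c)) x)"

text \<open>Meaningful at regular points of \<open>f\<close>, where the value does not depend on the chosen chart.\<close>

definition gaussian_curvature :: "'m chart set \<Rightarrow> ('m \<Rightarrow> real^3) \<Rightarrow> 'm \<Rightarrow> real" where
  "gaussian_curvature A f q =
     (let c = (SOME c. c \<in> A \<and> q \<in> fst c) in metric_curvature (pullback_metric c f) (snd c q))"

definition curvature_unbounded_near ::
  "'m::topological_space chart set \<Rightarrow> ('m \<Rightarrow> real^3) \<Rightarrow> 'm \<Rightarrow> bool" where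
  "curvature_unbounded_near A f p \<longleftrightarrow>
     (\<forall>U. open U \<and> p \<in> U \<longrightarrow> \<not> bounded (gaussian_curvature A f ` (U - singular_set A f)))"

text \<open>Some neighbourhood \<open>U\<close> of \<open>p\<close> is divided by the singular set into exactly two sides, connected
  and each adjacent to every singular point in \<open>U\<close>, on which the curvature has opposite signs.\<close>

definition curvature_changes_sign_across ::
  "'m::topological_space chart set \<Rightarrow> ('m \<Rightarrow> real^3) \<Rightarrow> 'm \<Rightarrow> bool" where
  "curvature_changes_sign_across A f p \<longleftrightarrow>
     (\<exists>U V\<^sub>1 V\<^sub>2. open U \<and> p \<in> U \<and>
        open V\<^sub>1 \<and> connected V\<^sub>1 \<and> open V\<^sub>2 \<and> connected V\<^sub>2 \<and> V\<^sub>1 \<inter> V\<^sub>2 = {} \<and>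
        U - singular_set A f = V\<^sub>1 \<union> V\<^sub>2 \<and>
        U \<inter> singular_set A f \<subseteq> closure V\<^sub>1 \<inter> closure V\<^sub>2 \<and>
        (\<forall>q\<in>V\<^sub>1. gaussian_curvature A f q > 0) \<and>
        (\<forall>q\<in>V\<^sub>2. gaussian_curvature A f q < 0))"

end

(*
Near a cuspidal edge there are coordinates (u,v) in which the front is B(u^2, u^3, v) with B a
diffeomorphism of the ambient space. Hence f_u = u a and f_v = b with a, b continuous and
everywhere independent, the singular set is u = 0, and the Gauss equation turns the curvature
into K = D / u with D = (a x b).(nu_u x nu_v) / |a x b|^2 continuous.
At p, f_u = 0 and the symmetry of the second fundamental form give b.nu_u = 0, so that
D(p) is proportional to (a.nu_u)(b.nu_v). Here a.nu_u is nonzero because (f, nu) is an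
immersion, and -b.nu_v is the only entry of the second fundamental form that can survive. So p is
generic iff D(p) is nonzero, in which case K behaves like a nonzero multiple of 1/u.
Along the singular curve, differentiating c'.nu = 0 gives c''.nu = -(v')^2 b.nu_v, which ties the
osculating plane to the same quantity.
*)
theory Submission
  imports Defs
begin

section \<open>Smooth functions and symmetry of second derivatives\<close>

text \<open>Two kinds of coordinates have to be kept apart. Smoothness is known in the charts of the
  atlas, and the curvature is computed from Christoffel symbols in a chart picked by choice, while
  the factorization of \<open>f\<close> lives in coordinates \<open>\<alpha>\<close> that may lie
  outside the atlas. Whatever involves second or third derivatives, namely the Gauss equation, the
  symmetry of the second fundamental form and the acceleration of the singular curve, is therefore
  done in an atlas chart. What crosses over to \<open>\<alpha>\<close> is first-order: derivatives
  of \<open>f\<close> and \<open>\<nu>\<close> change by an invertible linear map \<open>J\<close>.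
  The Gauss equation is written with (F_1 x F_2).(N_1 x N_2) / |F_1 x F_2|^2 for that reason:
  passing to the adapted frame multiplies the two cross products by u det J and det J, the
  determinant cancels, and one factor 1/u survives. The vector \<open>a\<close> is only a continuous
  extension of f_u / u, so its orthogonality to \<open>\<nu>\<close> at \<open>p\<close> has to come
  from a limit.\<close>

lemma smooth_on_has_derivative:
  "smooth_on S f \<Longrightarrow> x \<in> S \<Longrightarrow> (f has_derivative frechet_derivative f (at x)) (at x)"
  unfolding smooth_on_def frechet_derivative_works[symmetric]
  by (drule spec[where x = "Suc 0"]) simp

lemma smooth_on_frechet_derivative:
  "smooth_on S f \<Longrightarrow> smooth_on S (\<lambda>x. frechet_derivative f (at x) v)"
  unfolding smooth_on_def by (metis times_differentiable_on.simps(2))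

lemma smooth_on_partial: "smooth_on S f \<Longrightarrow> smooth_on S (partial i f)"
  unfolding partial_def[abs_def] by (rule smooth_on_frechet_derivative)

lemma smooth_on_continuous_on: "smooth_on S f \<Longrightarrow> continuous_on S f"
  unfolding smooth_on_def by (metis times_differentiable_on.simps(1))

lemma has_real_derivative_along_line:
  fixes g :: "'a::real_normed_vector \<Rightarrow> real"
  assumes "(g has_derivative G) (at (y + t *\<^sub>R v))"
  shows "((\<lambda>t. g (y + t *\<^sub>R v)) has_real_derivative G v) (at t)"
proof -
  have "((\<lambda>t. y + t *\<^sub>R v) has_derivative (\<lambda>h. h *\<^sub>R v)) (at t)"
    by (auto intro!: derivative_eq_intros)
  from has_derivative_compose[OF this assms]
  have "((\<lambda>t. g (y + t *\<^sub>R v)) has_derivative (\<lambda>h. G (h *\<^sub>R v))) (at t)" .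
  moreover have "G (h *\<^sub>R v) = G v * h" for h
    using linear_scale[OF has_derivative_linear[OF assms]] by simp
  ultimately show ?thesis
    by (simp add: has_field_derivative_def)
qed

text \<open>The mean value theorem is applied twice: along \<open>v\<close> to the increment of
  \<open>g\<close> by \<open>s\<close> times \<open>w\<close>, then along \<open>w\<close> to the
  directional derivative of \<open>g\<close> in direction \<open>v\<close>. Since the second
  difference is symmetric in \<open>v\<close> and \<open>w\<close>, exchanging them yields the other
  mixed derivative.\<close>

lemma second_difference_mean_value:
  fixes g :: "'a::real_normed_vector \<Rightarrow> real"
  assumes diff: "\<And>y. y \<in> ball x r \<Longrightarrow> g differentiable (at y)"
    and diff2: "\<And>y. y \<in> ball x r \<Longrightarrow> (\<lambda>y. frechet_derivative g (at y) v) differentiable (at y)"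
    and s: "0 < s" "s * (norm v + norm w) < r"
  shows "\<exists>y\<in>cball x (s * (norm v + norm w)).
     g (x + s *\<^sub>R v + s *\<^sub>R w) - g (x + s *\<^sub>R v) - g (x + s *\<^sub>R w) + g x
       = s\<^sup>2 * frechet_derivative (\<lambda>z. frechet_derivative g (at z) v) (at y) w"
proof -
  define h where "h y = frechet_derivative g (at y) v" for y
  have near: "norm (a *\<^sub>R v + b *\<^sub>R w) \<le> s * (norm v + norm w)"
    if "0 \<le> a" "a \<le> s" "0 \<le> b" "b \<le> s" for a b
  proof -
    have "norm (a *\<^sub>R v + b *\<^sub>R w) \<le> a * norm v + b * norm w"
      using that norm_triangle_ineq[of "a *\<^sub>R v" "b *\<^sub>R w"] by simp
    also have "\<dots> \<le> s * norm v + s * norm w"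
      using that by (intro add_mono mult_right_mono) auto
    finally show ?thesis by (simp add: algebra_simps)
  qed
  have inball: "x + a *\<^sub>R v + b *\<^sub>R w \<in> ball x r"
    if "0 \<le> a" "a \<le> s" "0 \<le> b" "b \<le> s" for a b
  proof -
    have "x - (x + a *\<^sub>R v + b *\<^sub>R w) = - (a *\<^sub>R v + b *\<^sub>R w)" by simp
    then have "dist x (x + a *\<^sub>R v + b *\<^sub>R w) = norm (a *\<^sub>R v + b *\<^sub>R w)"
      by (metis dist_norm norm_minus_cancel)
    then show ?thesis using near[OF that] s by simp
  qed
  have 1: "((\<lambda>a. g (x + b *\<^sub>R w + a *\<^sub>R v)) has_real_derivative h (x + a *\<^sub>R v + b *\<^sub>R w)) (at a)"
    if "0 \<le> a" "a \<le> s" "0 \<le> b" "b \<le> s" for a b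
    using has_real_derivative_along_line[of g _ "x + b *\<^sub>R w" a v]
      diff[OF inball[OF that]] unfolding frechet_derivative_works h_def
    by (simp add: add_ac)
  have "\<exists>a>0. a < s \<and>
      (g (x + s *\<^sub>R w + s *\<^sub>R v) - g (x + 0 *\<^sub>R w + s *\<^sub>R v))
      - (g (x + s *\<^sub>R w + 0 *\<^sub>R v) - g (x + 0 *\<^sub>R w + 0 *\<^sub>R v))
      = (s - 0) * (h (x + a *\<^sub>R v + s *\<^sub>R w) - h (x + a *\<^sub>R v + 0 *\<^sub>R w))"
    by (rule MVT2) (use s 1[of _ s] 1[of _ 0] in \<open>auto intro!: DERIV_diff\<close>)
  then obtain a where a: "0 < a" "a < s" and
    eq1: "g (x + s *\<^sub>R v + s *\<^sub>R w) - g (x + s *\<^sub>R v) - g (x + s *\<^sub>R w) + g x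
      = s * (h (x + a *\<^sub>R v + s *\<^sub>R w) - h (x + a *\<^sub>R v))"
    by (auto simp: add_ac algebra_simps)
  have 2: "((\<lambda>b. h (x + a *\<^sub>R v + b *\<^sub>R w)) has_real_derivative
      frechet_derivative h (at (x + a *\<^sub>R v + b *\<^sub>R w)) w) (at b)"
    if "0 \<le> b" "b \<le> s" for b
    using has_real_derivative_along_line[of h _ "x + a *\<^sub>R v" b w]
      diff2[OF inball[of a b]] a that unfolding frechet_derivative_works h_def[symmetric]
    by auto
  have "\<exists>b>0. b < s \<and> h (x + a *\<^sub>R v + s *\<^sub>R w) - h (x + a *\<^sub>R v + 0 *\<^sub>R w)
      = (s - 0) * frechet_derivative h (at (x + a *\<^sub>R v + b *\<^sub>R w)) w"
    by (rule MVT2) (use s 2 in auto)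
  then obtain b where b: "0 < b" "b < s" and
    eq2: "h (x + a *\<^sub>R v + s *\<^sub>R w) - h (x + a *\<^sub>R v)
      = s * frechet_derivative h (at (x + a *\<^sub>R v + b *\<^sub>R w)) w"
    by auto
  show ?thesis
  proof (rule bexI)
    have "x - (x + a *\<^sub>R v + b *\<^sub>R w) = - (a *\<^sub>R v + b *\<^sub>R w)" by simp
    then have "dist x (x + a *\<^sub>R v + b *\<^sub>R w) = norm (a *\<^sub>R v + b *\<^sub>R w)"
      by (metis dist_norm norm_minus_cancel)
    then show "x + a *\<^sub>R v + b *\<^sub>R w \<in> cball x (s * (norm v + norm w))"
      using near[of a b] a b by simp
  qed (use eq1 eq2 in \<open>simp add: h_def[abs_def] power2_eq_square\<close>)
qed

text \<open>One second difference equals \<open>s\<^sup>2\<close> times either mixed derivative,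
  each taken at some point close to \<open>x\<close>; continuity of both at \<open>x\<close>
  excludes a gap between them.\<close>

lemma second_derivative_symmetric_real:
  fixes g :: "'a::real_normed_vector \<Rightarrow> real"
  assumes S: "open S" "x \<in> S" and g: "smooth_on S g"
  shows "frechet_derivative (\<lambda>z. frechet_derivative g (at z) v) (at x) w
       = frechet_derivative (\<lambda>z. frechet_derivative g (at z) w) (at x) v"
    (is "?A x = ?B x")
proof (rule ccontr)
  assume ne: "?A x \<noteq> ?B x"
  \<comment> \<open>Half the gap: numbers at distance less than \<open>e\<close> from
    \<open>?A x\<close> and from \<open>?B x\<close> cannot coincide.\<close>
  define e where "e = \<bar>?A x - ?B x\<bar> / 2"
  have e: "e > 0" using ne by (simp add: e_def)
  have sm: "smooth_on S ?A" "smooth_on S ?B"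
    using g by (intro smooth_on_frechet_derivative; assumption)+
  have "isCont ?A x" "isCont ?B x"
    using sm[THEN smooth_on_continuous_on] S by (auto simp: continuous_on_eq_continuous_at)
  then have "\<forall>\<^sub>F y in nhds x. dist (?A y) (?A x) < e" "\<forall>\<^sub>F y in nhds x. dist (?B y) (?B x) < e"
    using e by (auto simp: isCont_def tendsto_iff eventually_at_filter elim!: eventually_mono)
  moreover have "\<forall>\<^sub>F y in nhds x. y \<in> S"
    using S by (simp add: eventually_nhds_in_open)
  ultimately have "\<forall>\<^sub>F y in nhds x. dist (?A y) (?A x) < e \<and> dist (?B y) (?B x) < e \<and> y \<in> S"
    by (intro eventually_conj)
  then obtain r where r: "r > 0" and
    close: "\<And>y. dist y x < r \<Longrightarrow> dist (?A y) (?A x) < e \<and> dist (?B y) (?B x) < e \<and> y \<in> S"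
    unfolding eventually_nhds_metric by auto
  define c where "c = norm v + norm w"
  \<comment> \<open>The summand 1 makes \<open>s * c\<close> strictly smaller than \<open>r\<close>
    and also covers \<open>v = w = 0\<close>.\<close>
  define s where "s = r / (c + 1)"
  have c: "c \<ge> 0" by (simp add: c_def)
  have s: "s > 0" using r c by (simp add: s_def)
  have "s * (norm v + norm w) < r"
    using r c unfolding c_def[symmetric] s_def by (simp add: field_simps)
  note sr = this
  have ball: "y \<in> S" if "y \<in> ball x r" for y using close that by (auto simp: dist_commute)
  have d0: "y \<in> ball x r \<Longrightarrow> g differentiable (at y)"
    and d1: "y \<in> ball x r \<Longrightarrow> (\<lambda>y. frechet_derivative g (at y) u) differentiable (at y)" for y u
    using ball g smooth_on_frechet_derivative[OF g, of u] smooth_on_has_derivative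
    by (auto simp: differentiable_def intro: smooth_on_has_derivative)
  obtain y where y: "y \<in> cball x (s * (norm v + norm w))" and
    ey: "g (x + s *\<^sub>R v + s *\<^sub>R w) - g (x + s *\<^sub>R v) - g (x + s *\<^sub>R w) + g x = s\<^sup>2 * ?A y"
    using second_difference_mean_value[of x r g v s w, OF d0 d1 s sr] by auto
  have sr': "s * (norm w + norm v) < r" using sr by (simp add: add.commute)
  obtain z where z: "z \<in> cball x (s * (norm w + norm v))" and
    ez: "g (x + s *\<^sub>R w + s *\<^sub>R v) - g (x + s *\<^sub>R w) - g (x + s *\<^sub>R v) + g x = s\<^sup>2 * ?B z"
    using second_difference_mean_value[of x r g w s v, OF d0 d1 s sr'] by auto
  have "s\<^sup>2 * ?A y = s\<^sup>2 * ?B z"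
    unfolding ey[symmetric] ez[symmetric] by (simp add: algebra_simps)
  then have eq: "?A y = ?B z" using s by simp
  have "dist (?A y) (?A x) < e" "dist (?B z) (?B x) < e"
    using close[of y] close[of z] y z sr sr' by (auto simp: dist_commute)
  with eq show False by (auto simp: e_def dist_real_def field_simps abs_if split: if_splits)
qed

lemma frechet_derivative_bounded_linear:
  assumes "bounded_linear h" "f differentiable (at x)"
  shows "frechet_derivative (\<lambda>x. h (f x)) (at x) v = h (frechet_derivative f (at x) v)"
proof -
  have "((\<lambda>x. h (f x)) has_derivative (\<lambda>v. h (frechet_derivative f (at x) v))) (at x)"
    using bounded_linear.has_derivative[OF assms(1)] assms(2)
    unfolding frechet_derivative_works by blast
  from frechet_derivative_at[OF this] show ?thesis by metis
qed

text \<open>This is what permits testing a vector-valued smooth map on inner products with a fixed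
  vector.\<close>

lemma smooth_on_bounded_linear:
  fixes f :: "'a::real_normed_vector \<Rightarrow> 'b::real_normed_vector" and h :: "'b \<Rightarrow> 'c::real_normed_vector"
  assumes "bounded_linear h" "open S" "smooth_on S f"
  shows "smooth_on S (\<lambda>x. h (f x))"
proof -
  \<comment> \<open>The derivative of the composite is known to be \<open>h\<close> of the
    derivative only at points of \<open>S\<close>, so the induction needs invariance under changes
    outside the open set \<open>S\<close>.\<close>
  have cong: "times_differentiable_on n S g' \<Longrightarrow> (\<And>x. x \<in> S \<Longrightarrow> g x = g' x) \<Longrightarrow>
      times_differentiable_on n S g" for n and g g' :: "'a \<Rightarrow> 'c"
  proof (induction n arbitrary: g g')
    case 0
    then show ?case by (simp cong: continuous_on_cong)
  next
    case (Suc n)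
    have d: "(g has_derivative G) (at x) \<longleftrightarrow> (g' has_derivative G) (at x)" if "x \<in> S" for x G
      using has_derivative_transform_within_open[OF _ assms(2) that] Suc.prems(2) by metis
    then have eq: "frechet_derivative g (at x) = frechet_derivative g' (at x)" if "x \<in> S" for x
      using that by (simp add: frechet_derivative_def)
    show ?case
      using Suc.prems(1) Suc.IH[of "\<lambda>x. frechet_derivative g' (at x) _" "\<lambda>x. frechet_derivative g (at x) _"]
        d eq by (auto simp: differentiable_def)
  qed
  have "times_differentiable_on n S f \<Longrightarrow> times_differentiable_on n S (\<lambda>x. h (f x))" for n
  proof (induction n arbitrary: f)
    case 0
    then show ?case
      using linear_continuous_on_compose bounded_linear.linear
      by (simp add: bounded_linear.continuous_on[OF assms(1)])
  next
    case (Suc n)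
    then have "(\<lambda>x. h (f x)) differentiable (at x)" if "x \<in> S" for x
      using that bounded_linear.has_derivative[OF assms(1)] Suc.prems
      unfolding differentiable_def times_differentiable_on.simps by blast
    moreover have "times_differentiable_on n S (\<lambda>x. frechet_derivative (\<lambda>x. h (f x)) (at x) v)" for v
      by (rule cong[OF Suc.IH[of "\<lambda>x. frechet_derivative f (at x) v"]])
        (use Suc.prems in \<open>auto simp: frechet_derivative_bounded_linear[OF assms(1)]\<close>)
    ultimately show ?case by simp
  qed
  then show ?thesis using assms(3) by (simp add: smooth_on_def)
qed

text \<open>A vector is determined by its inner products, so the real case is applied to the inner
  product of \<open>f\<close> with every fixed \<open>e\<close>.\<close>

lemma second_derivative_symmetric:
  fixes f :: "'a::real_normed_vector \<Rightarrow> 'b::real_inner"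
  assumes S: "open S" "x \<in> S" and f: "smooth_on S f"
  shows "frechet_derivative (\<lambda>z. frechet_derivative f (at z) v) (at x) w
       = frechet_derivative (\<lambda>z. frechet_derivative f (at z) w) (at x) v"
    (is "?A v w = ?A w v")
proof -
  have "e \<bullet> ?A v w = e \<bullet> ?A w v" for e
  proof -
    have bl: "bounded_linear (\<lambda>y. e \<bullet> y)" by (rule bounded_linear_inner_right)
    have d: "y \<in> S \<Longrightarrow> frechet_derivative (\<lambda>x. e \<bullet> f x) (at y) u = e \<bullet> frechet_derivative f (at y) u" for y u
      using frechet_derivative_bounded_linear[OF bl, of f y u] smooth_on_has_derivative[OF f, of y]
      by (metis differentiableI)
    have "frechet_derivative (\<lambda>z. frechet_derivative (\<lambda>x. e \<bullet> f x) (at z) u) (at x) u'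
        = e \<bullet> ?A u u'" for u u'
    proof -
      have sm: "((\<lambda>z. frechet_derivative f (at z) u) has_derivative ?A u) (at x)"
        using smooth_on_has_derivative[OF smooth_on_frechet_derivative[OF f] S(2)] by simp
      have "((\<lambda>z. frechet_derivative (\<lambda>x. e \<bullet> f x) (at z) u) has_derivative (\<lambda>u'. e \<bullet> ?A u u')) (at x)"
        by (rule has_derivative_transform_within_open[OF bounded_linear.has_derivative[OF bl sm] S])
          (simp add: d)
      from frechet_derivative_at[OF this] show ?thesis by metis
    qed
    then show ?thesis
      using second_derivative_symmetric_real[OF S smooth_on_bounded_linear[OF bl S(1) f]] by metis
  qed
  then show ?thesis by (metis vector_eq_rdot inner_commute)
qed

section \<open>The Gauss equation\<close>

lemma smooth_on_differentiable: "smooth_on S f \<Longrightarrow> x \<in> S \<Longrightarrow> f differentiable (at x)"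
  using smooth_on_has_derivative by (auto simp: differentiable_def)

lemma partial_eq:
  assumes "(f has_derivative f') (at x)"
  shows "partial i f x = f' (axis i 1)"
  using frechet_derivative_at[OF assms] by (simp add: partial_def)

lemma differentiable_transform_open:
  assumes "g differentiable (at x)" "open T" "x \<in> T" "\<And>y. y \<in> T \<Longrightarrow> f y = g y"
  shows "f differentiable (at x)"
  using assms has_derivative_transform_within_open[of g _ x UNIV T f]
  unfolding differentiable_def by metis

lemma partial_transform_open:
  assumes "open T" "x \<in> T" "\<And>y. y \<in> T \<Longrightarrow> f y = g y" "g differentiable (at x)"
  shows "partial i f x = partial i g x"
  using has_derivative_transform_within_open[of g _ x UNIV T f] assms
  by (metis frechet_derivative_works partial_def partial_eq)

lemma partial_inner:
  assumes "f differentiable (at x)" "g differentiable (at x)"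
  shows "partial i (\<lambda>y. f y \<bullet> g y) x = partial i f x \<bullet> g x + f x \<bullet> partial i g x"
  using partial_eq[OF has_derivative_inner[OF assms[unfolded frechet_derivative_works]]]
  by (simp add: partial_def)

lemma partial_add:
  assumes "f differentiable (at x)" "g differentiable (at x)"
  shows "partial i (\<lambda>y. f y + g y) x = partial i f x + partial i g x"
  using partial_eq[OF has_derivative_add[OF assms[unfolded frechet_derivative_works]]]
  by (simp add: partial_def)

lemma partial_mult:
  fixes f g :: "real^2 \<Rightarrow> real"
  assumes "f differentiable (at x)" "g differentiable (at x)"
  shows "partial i (\<lambda>y. f y * g y) x = partial i f x * g x + f x * partial i g x"
  using partial_inner[OF assms] by simp

lemma partial_symmetric:
  fixes f :: "real^2 \<Rightarrow> 'b::real_inner"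
  assumes "open S" "x \<in> S" "smooth_on S f"
  shows "partial i (partial j f) x = partial j (partial i f) x"
  using second_derivative_symmetric[OF assms] by (simp add: partial_def[abs_def])

text \<open>The orthogonal complement of an independent pair is the line through
  \<open>cross3 a b\<close>, so \<open>w\<close> and the unit vector \<open>n\<close> are both
  multiples of it. This gives the normal part in the Gauss formula and, later, the contradiction
  behind \<open>a_n1\<close>.\<close>

lemma orthogonal_to_plane_eq:
  fixes a b n w :: "real^3"
  assumes "cross3 a b \<noteq> 0" and n: "norm n = 1" "a \<bullet> n = 0" "b \<bullet> n = 0"
    and w: "a \<bullet> w = 0" "b \<bullet> w = 0"
  shows "w = (w \<bullet> n) *\<^sub>R n"
proof -
  have normal: "\<exists>t. u = t *\<^sub>R cross3 a b" if "a \<bullet> u = 0" "b \<bullet> u = 0" for u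
  proof -
    have "cross3 u (cross3 a b) = 0"
      using that by (simp add: Lagrange inner_commute)
    then have "collinear {0, cross3 a b, u}"
      by (metis cross_eq_0 insert_commute)
    then show ?thesis
      using assms(1) by (auto simp: collinear_lemma)
  qed
  obtain s t where s: "w = s *\<^sub>R cross3 a b" and t: "n = t *\<^sub>R cross3 a b"
    using normal n w by metis
  have "n \<bullet> n = 1" using n(1) by (simp add: dot_square_norm)
  then have "t * t * (cross3 a b \<bullet> cross3 a b) = 1" using t by simp
  then show ?thesis unfolding s t by (simp add: mult_ac)
qed

text \<open>With the metric as \<open>A\<close>, this lowers the upper index of a Christoffel
  symbol, whose definition carries the inverse metric.\<close>

lemma matrix_inv_mult_vector_2:
  fixes A :: "real^2^2"
  assumes "det A \<noteq> 0"
  shows "A $ l $ 1 * (\<Sum>m\<in>UNIV. matrix_inv A $ 1 $ m * b m)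
       + A $ l $ 2 * (\<Sum>m\<in>UNIV. matrix_inv A $ 2 $ m * b m) = b l"
proof -
  have "invertible A" using assms by (simp add: invertible_det_nz)
  then have "A ** matrix_inv A = mat 1"
    unfolding invertible_def matrix_inv_def by (rule someI2_ex) simp
  then have "A *v (matrix_inv A *v (\<chi> m. b m)) = (\<chi> m. b m)"
    by (simp add: matrix_vector_mul_assoc)
  then have "(A *v (matrix_inv A *v (\<chi> m. b m))) $ l = b l" by simp
  then show ?thesis by (simp add: matrix_vector_mult_def sum_2)
qed

text \<open>Each second derivative F_ij splits into a tangential part, whose coefficients are the
  Christoffel symbols, and h_ij N. Inserted into the curvature tensor, this leaves h_11 h_22 -
  h_12^2, because the third derivatives of F cancel. The formula for the inner product of two cross
  products gives the stated form, in which a change of coordinates acts by determinants.\<close>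

theorem theorema_egregium:
  fixes F N :: "real^2 \<Rightarrow> real^3"
  assumes S: "open S" "x \<in> S" and F: "smooth_on S F" and N: "smooth_on S N"
    and unit: "norm (N x) = 1" and normal: "\<And>y i. y \<in> S \<Longrightarrow> partial i F y \<bullet> N y = 0"
    and reg: "cross3 (partial 1 F x) (partial 2 F x) \<noteq> 0"
  shows "metric_curvature (\<lambda>y. \<chi> i j. partial i F y \<bullet> partial j F y) x =
      (cross3 (partial 1 F x) (partial 2 F x) \<bullet> cross3 (partial 1 N x) (partial 2 N x))
      / (norm (cross3 (partial 1 F x) (partial 2 F x)))\<^sup>2"
proof -
  define g :: "real^2 \<Rightarrow> real^2^2" where "g = (\<lambda>y. \<chi> i j. partial i F y \<bullet> partial j F y)"
  have g: "g y $ i $ j = partial i F y \<bullet> partial j F y" for y i j by (simp add: g_def)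
  have d1: "partial i F differentiable (at y)" if "y \<in> S" for i y
    using smooth_on_differentiable[OF smooth_on_partial[OF F] that] .
  have d2: "partial i (partial j F) differentiable (at y)" if "y \<in> S" for i j y
    using smooth_on_differentiable[OF smooth_on_partial[OF smooth_on_partial[OF F]] that] .
  have dg: "(\<lambda>y. g y $ i $ j) differentiable (at y)" if "y \<in> S" for i j y
    unfolding g using d1[OF that] by (intro differentiable_inner)
  have sym: "partial i (partial j F) y = partial j (partial i F) y" if "y \<in> S" for i j y
    using partial_symmetric[OF S(1) that F] .
  have pg: "partial k (\<lambda>z. g z $ i $ j) y =
      partial k (partial i F) y \<bullet> partial j F y + partial i F y \<bullet> partial k (partial j F) y"
    if "y \<in> S" for i j k y
    unfolding g using partial_inner[OF d1[OF that] d1[OF that]] .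
  have gsym: "g y $ i $ j = g y $ j $ i" for i j y by (simp add: g inner_commute)
  have det: "det (g y) = cross3 (partial 1 F y) (partial 2 F y) \<bullet> cross3 (partial 1 F y) (partial 2 F y)" for y
    by (simp add: det_2 g dot_cross inner_commute)
  \<comment> \<open>The curvature tensor differentiates the Christoffel symbols, so formulas for
    them are needed on a neighbourhood of \<open>x\<close>; this is the open set where the metric is
    nondegenerate.\<close>
  define T where "T = S \<inter> (\<lambda>y. det (g y)) -` (- {0})"
  have cg: "continuous_on S (\<lambda>y. g y $ i $ j)" for i j
    using dg by (intro differentiable_imp_continuous_on) (auto simp: differentiable_on_def intro: differentiable_at_withinI)
  have "continuous_on S (\<lambda>y. det (g y))"
    unfolding det_2 by (intro continuous_on_diff continuous_on_mult cg)
  then have T: "open T"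
    unfolding T_def using S(1) by (intro continuous_open_preimage) auto
  have TS: "y \<in> S" and Tdet: "det (g y) \<noteq> 0" if "y \<in> T" for y
    using that by (auto simp: T_def)
  have xT: "x \<in> T" using S(2) reg by (simp add: T_def det)
  \<comment> \<open>Once mixed partials are exchanged, the three metric derivatives in a Christoffel
    symbol add up to twice F_ij.F_l, and contraction with \<open>g\<close> removes the inverse
    matrix.\<close>
  have low: "g y $ l $ 1 * christoffel g 1 i j y + g y $ l $ 2 * christoffel g 2 i j y
      = partial i (partial j F) y \<bullet> partial l F y" if "y \<in> T" for i j l y
  proof -
    have "christoffel g k i j y =
        (\<Sum>l\<in>UNIV. matrix_inv (g y) $ k $ l * (partial i (partial j F) y \<bullet> partial l F y))" for k
      unfolding christoffel_def sum_distrib_left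
      using TS[OF that] sym[OF TS[OF that]]
      by (intro sum.cong refl) (simp add: pg inner_commute algebra_simps)
    then show ?thesis
      using matrix_inv_mult_vector_2[OF Tdet[OF that]] by simp
  qed
  \<comment> \<open>Cramer's rule exhibits the symbols as quotients of differentiable functions,
    which is how their differentiability on \<open>T\<close> is obtained.\<close>
  have cramer1: "christoffel g 1 i j y =
      (partial i (partial j F) y \<bullet> partial 1 F y * g y $ 2 $ 2
       - partial i (partial j F) y \<bullet> partial 2 F y * g y $ 1 $ 2) / det (g y)"
    and cramer2: "christoffel g 2 i j y =
      (partial i (partial j F) y \<bullet> partial 2 F y * g y $ 1 $ 1
       - partial i (partial j F) y \<bullet> partial 1 F y * g y $ 2 $ 1) / det (g y)"
    if "y \<in> T" for i j y
    unfolding eq_divide_eq using Tdet[OF that]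
    by (simp_all add: low[OF that, symmetric] det_2 algebra_simps)
  have dc: "christoffel g k i j differentiable (at y)" if "y \<in> T" for i j k y
  proof -
    have *: "(\<lambda>y. (partial i (partial j F) y \<bullet> partial a F y * g y $ b $ c
       - partial i (partial j F) y \<bullet> partial b' F y * g y $ a' $ c') / det (g y)) differentiable (at y)"
      for a b c a' b' c'
      using TS[OF that] Tdet[OF that] dg d1 d2 unfolding det_2
      by (intro differentiable_divide differentiable_diff differentiable_mult differentiable_inner) auto
    have "christoffel g 1 i j differentiable (at y)"
      using * cramer1 by (rule differentiable_transform_open[OF _ T that])
    moreover have "christoffel g 2 i j differentiable (at y)"
      using * cramer2 by (rule differentiable_transform_open[OF _ T that])
    ultimately show ?thesis using exhaust_2[of k] by auto
  qed
  (* Differentiating the lowered symbols instead of the Christoffel symbols themselves avoids the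
     derivative of the inverse metric. *)
  have dlow: "partial m (\<lambda>y. g y $ l $ 1) x * christoffel g 1 i j x
      + g x $ l $ 1 * partial m (christoffel g 1 i j) x
      + partial m (\<lambda>y. g y $ l $ 2) x * christoffel g 2 i j x
      + g x $ l $ 2 * partial m (christoffel g 2 i j) x
      = partial m (partial i (partial j F)) x \<bullet> partial l F x
      + partial i (partial j F) x \<bullet> partial m (partial l F) x" for m l i j
  proof -
    note ds = dg[OF S(2)] dc[OF xT] d1[OF S(2)] d2[OF S(2)]
    have "partial m (\<lambda>y. g y $ l $ 1 * christoffel g 1 i j y + g y $ l $ 2 * christoffel g 2 i j y) x
      = partial m (\<lambda>y. partial i (partial j F) y \<bullet> partial l F y) x"
      using low by (intro partial_transform_open[OF T xT] differentiable_inner ds)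
    then show ?thesis
      by (simp add: partial_add partial_mult partial_inner ds algebra_simps)
  qed
  \<comment> \<open>The Gauss formula: after removal of the tangential part of F_ij, the remainder
    is orthogonal to both partials and hence equals h_ij N.\<close>
  define w where "w i j = partial i (partial j F) x - christoffel g 1 i j x *\<^sub>R partial 1 F x
      - christoffel g 2 i j x *\<^sub>R partial 2 F x" for i j
  define h where "h i j = partial i (partial j F) x \<bullet> N x" for i j
  have "partial l F x \<bullet> w i j = 0" for l i j
    using low[OF xT, of l i j] by (simp add: w_def inner_diff_right g inner_commute algebra_simps)
  then have "w i j = (w i j \<bullet> N x) *\<^sub>R N x" for i j
    using orthogonal_to_plane_eq[OF reg unit normal[OF S(2)] normal[OF S(2)]] by blast
  moreover have wN: "w i j \<bullet> N x = h i j" for i j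
    using normal[OF S(2)] by (simp add: w_def inner_diff_left h_def)
  ultimately have "w i j \<bullet> partial k (partial l F) x = h i j * h k l" for i j k l
    by (metis h_def inner_commute inner_scaleR_left)
  then have gauss: "partial i (partial j F) x \<bullet> partial k (partial l F) x
      - christoffel g 1 i j x * (partial 1 F x \<bullet> partial k (partial l F) x)
      - christoffel g 2 i j x * (partial 2 F x \<bullet> partial k (partial l F) x) = h i j * h k l" for i j k l
    by (simp add: w_def inner_diff_left)
  have hN: "h i j = - (partial j F x \<bullet> partial i N x)" for i j
  proof -
    have "partial i (\<lambda>y. partial j F y \<bullet> N y) x = partial i (\<lambda>y. 0) x"
      using normal by (intro partial_transform_open[OF S]) auto
    then show ?thesis
      using partial_inner[OF d1[OF S(2)] smooth_on_differentiable[OF N S(2)], of i j]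
      by (simp add: h_def partial_def)
  qed
  have numerator: "(\<Sum>l\<in>UNIV. riemann g l 2 1 2 x * g x $ l $ 1) = h 2 2 * h 1 1 - h 1 2 * h 1 2"
  proof -
    define \<Gamma> where "\<Gamma> k i j = christoffel g k i j x" for k i j
    \<comment> \<open>The two instances of \<open>dlow\<close> used below contain these two third
      derivatives; their equality cancels them on subtraction.\<close>
    have third: "partial 2 (partial 1 (partial 2 F)) x = partial 1 (partial 2 (partial 2 F)) x"
      using partial_symmetric[OF S smooth_on_partial[OF F]] .
    \<comment> \<open>Contracting the quadratic terms with the first row of the metric lowers one
      factor in each product, so \<open>low\<close> turns it into an inner product of derivatives of
      F.\<close>
    have quadratic: "(\<Gamma> 1 1 1 * \<Gamma> 1 2 2 + \<Gamma> 1 1 2 * \<Gamma> 2 2 2 - \<Gamma> 1 2 1 * \<Gamma> 1 1 2 - \<Gamma> 1 2 2 * \<Gamma> 2 1 2) * g x $ 1 $ 1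
      + (\<Gamma> 2 1 1 * \<Gamma> 1 2 2 + \<Gamma> 2 1 2 * \<Gamma> 2 2 2 - \<Gamma> 2 2 1 * \<Gamma> 1 1 2 - \<Gamma> 2 2 2 * \<Gamma> 2 1 2) * g x $ 1 $ 2
      = (partial 1 (partial 1 F) x \<bullet> partial 1 F x) * \<Gamma> 1 2 2
      + (partial 1 (partial 2 F) x \<bullet> partial 1 F x) * \<Gamma> 2 2 2
      - (partial 2 (partial 1 F) x \<bullet> partial 1 F x) * \<Gamma> 1 1 2
      - (partial 2 (partial 2 F) x \<bullet> partial 1 F x) * \<Gamma> 2 1 2"
      unfolding low[OF xT, symmetric] \<Gamma>_def by (simp add: algebra_simps)
    have "(\<Sum>l\<in>UNIV. riemann g l 2 1 2 x * g x $ l $ 1)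
      = (g x $ 1 $ 1 * partial 1 (christoffel g 1 2 2) x + g x $ 1 $ 2 * partial 1 (christoffel g 2 2 2) x)
      - (g x $ 1 $ 1 * partial 2 (christoffel g 1 1 2) x + g x $ 1 $ 2 * partial 2 (christoffel g 2 1 2) x)
      + ((\<Gamma> 1 1 1 * \<Gamma> 1 2 2 + \<Gamma> 1 1 2 * \<Gamma> 2 2 2 - \<Gamma> 1 2 1 * \<Gamma> 1 1 2 - \<Gamma> 1 2 2 * \<Gamma> 2 1 2) * g x $ 1 $ 1
      + (\<Gamma> 2 1 1 * \<Gamma> 1 2 2 + \<Gamma> 2 1 2 * \<Gamma> 2 2 2 - \<Gamma> 2 2 1 * \<Gamma> 1 1 2 - \<Gamma> 2 2 2 * \<Gamma> 2 1 2) * g x $ 1 $ 2)"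
      unfolding riemann_def sum_2 \<Gamma>_def gsym[of x 2 1] by (simp add: algebra_simps)
    also have "\<dots> = h 2 2 * h 1 1 - h 1 2 * h 1 2"
      unfolding quadratic
      using dlow[of 1 1 2 2] dlow[of 2 1 1 2] gauss[of 2 2 1 1] gauss[of 1 2 1 2]
      unfolding pg[OF S(2)] third sym[OF S(2), of 2 1] \<Gamma>_def
      by (simp add: inner_commute algebra_simps)
    finally show ?thesis .
  qed
  have "h 1 2 = h 2 1" using sym[OF S(2)] by (simp add: h_def)
  then have "h 2 2 * h 1 1 - h 1 2 * h 1 2
      = cross3 (partial 1 F x) (partial 2 F x) \<bullet> cross3 (partial 1 N x) (partial 2 N x)"
    by (simp add: hN dot_cross)
  then show ?thesis
    unfolding metric_curvature_def numerator[unfolded g_def] power2_norm_eq_inner det[symmetric]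
    by (simp add: g_def)
qed

section \<open>Change of coordinates on the surface\<close>

lemma open_embeddingD:
  assumes "open_embedding U \<phi>"
  shows "open U" "open (\<phi> ` U)" "inj_on \<phi> U" "continuous_on U \<phi>" "continuous_on (\<phi> ` U) (inv_into U \<phi>)"
    and "\<And>q. q \<in> U \<Longrightarrow> inv_into U \<phi> (\<phi> q) = q"
proof -
  have h: "homeomorphism U (\<phi> ` U) \<phi> (inv_into U \<phi>)" and o: "open U" "open (\<phi> ` U)"
    using assms by (auto simp: open_embedding_def)
  show "open U" "open (\<phi> ` U)" by fact+
  show inv: "\<And>q. q \<in> U \<Longrightarrow> inv_into U \<phi> (\<phi> q) = q"
    using homeomorphism_apply1[OF h] .
  then show "inj_on \<phi> U" by (rule inj_on_inverseI)
  show "continuous_on U \<phi>" "continuous_on (\<phi> ` U) (inv_into U \<phi>)"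
    using h by (auto simp: homeomorphism_def)
qed

lemma open_embedding_image_open:
  assumes "open_embedding U \<phi>" "open W"
  shows "open (\<phi> ` (U \<inter> W))"
proof -
  have "openin (top_of_set (\<phi> ` U)) (\<phi> ` (U \<inter> W))"
    using assms homeomorphism_imp_open_map[of U "\<phi> ` U" \<phi> "inv_into U \<phi>"]
    by (simp add: open_embedding_def openin_open_Int)
  then show ?thesis
    using assms(1) openin_open_trans by (auto simp: open_embedding_def)
qed

lemma open_embedding_preimage_open:
  assumes "open_embedding U \<phi>" "open W"
  shows "open (U \<inter> \<phi> -` W)"
  using open_embeddingD[OF assms(1)] assms(2) by (intro continuous_open_preimage)

lemma oriented_atlas_chart:
  assumes "oriented_atlas A" "(U, \<phi>) \<in> A"
  shows "open_embedding U \<phi>"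
  using assms by (auto simp: oriented_atlas_def)

lemma oriented_atlas_cover:
  assumes "oriented_atlas A"
  obtains U \<phi> where "(U, \<phi>) \<in> A" "q \<in> U"
proof -
  have "q \<in> (\<Union>(U,\<phi>)\<in>A. U)" using assms by (simp add: oriented_atlas_def)
  then show thesis using that by auto
qed

text \<open>The chain rule for the identity. It serves twice: for coordinate changes on the surface
  and for the ambient diffeomorphism in the normal form of a cuspidal edge.\<close>

lemma left_inverse_derivative:
  assumes "(f has_derivative f') (at x)" "(g has_derivative g') (at (f x))"
    and "open S" "x \<in> S" "\<And>y. y \<in> S \<Longrightarrow> g (f y) = y"
  shows "g' (f' v) = v"
proof -
  have "((\<lambda>y. g (f y)) has_derivative (\<lambda>v. g' (f' v))) (at x)"
    using has_derivative_compose[OF assms(1,2)] .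
  moreover have "((\<lambda>y. g (f y)) has_derivative (\<lambda>v. v)) (at x)"
    using has_derivative_transform_within_open[OF has_derivative_ident assms(3,4)] assms(5) by metis
  ultimately show ?thesis
    using has_derivative_unique by metis
qed

lemma vec2_decomposition: "x = x $ 1 *\<^sub>R axis 1 1 + x $ 2 *\<^sub>R axis 2 1" for x :: "real^2"
  by (simp add: vec_eq_iff forall_2 axis_def)

lemma linear_on_real2:
  fixes L :: "real^2 \<Rightarrow> 'b::real_vector"
  assumes "linear L"
  shows "L x = x $ 1 *\<^sub>R L (axis 1 1) + x $ 2 *\<^sub>R L (axis 2 1)"
  using arg_cong[OF vec2_decomposition[of x], of L]
  by (simp only: linear_add[OF assms] linear_scale[OF assms])

lemma has_derivative_partials:
  assumes "f differentiable (at x)"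
  shows "(f has_derivative (\<lambda>v. v $ 1 *\<^sub>R partial 1 f x + v $ 2 *\<^sub>R partial 2 f x)) (at x)"
proof -
  have "frechet_derivative f (at x) = (\<lambda>v. v $ 1 *\<^sub>R partial 1 f x + v $ 2 *\<^sub>R partial 2 f x)"
    unfolding partial_def by (rule ext, rule linear_on_real2[OF linear_frechet_derivative[OF assms]])
  then show ?thesis
    using assms by (metis frechet_derivative_works)
qed

text \<open>The chain rule expresses the partials of the composite through continuous functions.
  This gives the continuity of the derivatives of \<open>\<nu>\<close> in the adapted
  coordinates.\<close>

lemma continuous_on_partial_compose:
  fixes s :: "real^2 \<Rightarrow> real^2"
  assumes "smooth_on S s" "smooth_on T G" "s ` S \<subseteq> T"
  shows "continuous_on S (partial i (G \<circ> s))"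
proof -
  have eq: "partial i (G \<circ> s) z = partial i s z $ 1 *\<^sub>R partial 1 G (s z) + partial i s z $ 2 *\<^sub>R partial 2 G (s z)"
    if "z \<in> S" for z
  proof -
    have "(G has_derivative (\<lambda>v. v $ 1 *\<^sub>R partial 1 G (s z) + v $ 2 *\<^sub>R partial 2 G (s z))) (at (s z))"
      using that assms by (intro has_derivative_partials smooth_on_differentiable[of T]) auto
    from has_derivative_compose[OF smooth_on_has_derivative[OF assms(1) that] this]
    show ?thesis by (simp add: o_def partial_eq) (simp add: partial_def)
  qed
  have s: "continuous_on S s" "continuous_on S (partial i s)"
    using assms(1) by (intro smooth_on_continuous_on smooth_on_partial; assumption)+
  have "continuous_on T (partial k G)" for k
    using assms(2) by (intro smooth_on_continuous_on smooth_on_partial)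
  then have G: "continuous_on S (\<lambda>z. partial k G (s z))" for k
    using continuous_on_compose2[OF _ s(1) assms(3)] by blast
  have "continuous_on S (\<lambda>z. partial i s z $ 1 *\<^sub>R partial 1 G (s z) + partial i s z $ 2 *\<^sub>R partial 2 G (s z))"
    by (intro continuous_on_add continuous_on_scaleR continuous_on_component G s)
  then show ?thesis
    using eq by (simp cong: continuous_on_cong)
qed

lemma push_eq:
  assumes "((g \<circ> inv_into U \<phi>) has_derivative g') (at (\<phi> q))"
  shows "push (U, \<phi>) g q X = g' X"
  using frechet_derivative_at[OF assms] by (simp add: push_def)

section \<open>Comparison of atlas charts with other coordinates on the surface\<close>

context
  fixes A :: "'m::{t2_space,second_countable_topology} chart set" and V \<alpha>
  assumes atlas: "oriented_atlas A" and coord: "surface_diffeo A V \<alpha>"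
begin

lemma coordinates_embedding: "open_embedding V \<alpha>"
  using coord by (simp add: surface_diffeo_def)

lemma transition_smooth:
  assumes "(U, \<phi>) \<in> A"
  shows "smooth_on (\<phi> ` (U \<inter> V)) (\<alpha> \<circ> inv_into U \<phi>)" "smooth_on (\<alpha> ` (U \<inter> V)) (\<phi> \<circ> inv_into V \<alpha>)"
  using coord assms by (auto simp: surface_diffeo_def)

lemma transition_open:
  assumes "(U, \<phi>) \<in> A"
  shows "open (\<phi> ` (U \<inter> V))" "open (\<alpha> ` (U \<inter> V))"
  using open_embedding_image_open[OF oriented_atlas_chart[OF atlas assms], of V]
    open_embedding_image_open[OF coordinates_embedding, of U]
    open_embeddingD(1)[OF oriented_atlas_chart[OF atlas assms]]
    open_embeddingD(1)[OF coordinates_embedding]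
  by (auto simp: Int_commute)

text \<open>\<open>J\<close> carries components in the chart to components with respect to
  \<open>\<alpha>\<close>, and \<open>K\<close> carries them back; they are inverse because the
  transition maps are.\<close>

lemma transition_derivative:
  assumes "(U, \<phi>) \<in> A" "q \<in> U" "q \<in> V"
  obtains J K where "((\<alpha> \<circ> inv_into U \<phi>) has_derivative J) (at (\<phi> q))"
    "((\<phi> \<circ> inv_into V \<alpha>) has_derivative K) (at (\<alpha> q))"
    "\<And>X. J (K X) = X" "\<And>X. K (J X) = X"
proof -
  note emb = oriented_atlas_chart[OF atlas assms(1)]
  let ?\<tau> = "\<alpha> \<circ> inv_into U \<phi>" and ?\<sigma> = "\<phi> \<circ> inv_into V \<alpha>"
  define J where "J = frechet_derivative ?\<tau> (at (\<phi> q))"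
  define K where "K = frechet_derivative ?\<sigma> (at (\<alpha> q))"
  have inv: "q \<in> U \<Longrightarrow> inv_into U \<phi> (\<phi> q) = q" "q \<in> V \<Longrightarrow> inv_into V \<alpha> (\<alpha> q) = q" for q
    using open_embeddingD(6)[OF emb] open_embeddingD(6)[OF coordinates_embedding] by auto
  have J: "(?\<tau> has_derivative J) (at (\<phi> q))"
    unfolding J_def using assms by (intro smooth_on_has_derivative[OF transition_smooth(1)]) auto
  have K: "(?\<sigma> has_derivative K) (at (\<alpha> q))"
    unfolding K_def using assms by (intro smooth_on_has_derivative[OF transition_smooth(2)]) auto
  have "J (K X) = X" for X
    by (rule left_inverse_derivative[OF K, of ?\<tau>, OF _ transition_open(2)[OF assms(1)]])
      (use J assms inv in auto)
  moreover have "K (J X) = X" for X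
    by (rule left_inverse_derivative[OF J, of ?\<sigma>, OF _ transition_open(1)[OF assms(1)]])
      (use K assms inv in auto)
  ultimately show thesis using that J K by blast
qed

lemma chart_to_coordinates:
  assumes "(U, \<phi>) \<in> A" "q \<in> U" "q \<in> V"
    and "((\<phi> \<circ> inv_into V \<alpha>) has_derivative K) (at (\<alpha> q))"
    and "((g \<circ> inv_into U \<phi>) has_derivative g') (at (\<phi> q))"
  shows "((g \<circ> inv_into V \<alpha>) has_derivative (\<lambda>X. g' (K X))) (at (\<alpha> q))"
proof (rule has_derivative_transform_within_open)
  note inv = open_embeddingD(6)[OF oriented_atlas_chart[OF atlas assms(1)]]
    open_embeddingD(6)[OF coordinates_embedding]
  show "((\<lambda>y. (g \<circ> inv_into U \<phi>) ((\<phi> \<circ> inv_into V \<alpha>) y)) has_derivative (\<lambda>X. g' (K X))) (at (\<alpha> q))"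
    using has_derivative_compose[OF assms(4), of "g \<circ> inv_into U \<phi>" g'] assms inv by simp
  show "open (\<alpha> ` (U \<inter> V))" using transition_open[OF assms(1)] by simp
  show "\<alpha> q \<in> \<alpha> ` (U \<inter> V)" using assms by auto
  show "\<And>y. y \<in> \<alpha> ` (U \<inter> V) \<Longrightarrow> (g \<circ> inv_into U \<phi>) ((\<phi> \<circ> inv_into V \<alpha>) y) = (g \<circ> inv_into V \<alpha>) y"
    using inv by auto
qed

lemma coordinates_to_chart:
  assumes "(U, \<phi>) \<in> A" "q \<in> U" "q \<in> V"
    and "((\<alpha> \<circ> inv_into U \<phi>) has_derivative J) (at (\<phi> q))"
    and "((g \<circ> inv_into V \<alpha>) has_derivative g') (at (\<alpha> q))"
  shows "((g \<circ> inv_into U \<phi>) has_derivative (\<lambda>X. g' (J X))) (at (\<phi> q))"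
proof (rule has_derivative_transform_within_open)
  note inv = open_embeddingD(6)[OF oriented_atlas_chart[OF atlas assms(1)]]
    open_embeddingD(6)[OF coordinates_embedding]
  show "((\<lambda>y. (g \<circ> inv_into V \<alpha>) ((\<alpha> \<circ> inv_into U \<phi>) y)) has_derivative (\<lambda>X. g' (J X))) (at (\<phi> q))"
    using has_derivative_compose[OF assms(4), of "g \<circ> inv_into V \<alpha>" g'] assms inv by simp
  show "open (\<phi> ` (U \<inter> V))" using transition_open[OF assms(1)] by simp
  show "\<phi> q \<in> \<phi> ` (U \<inter> V)" using assms by auto
  show "\<And>y. y \<in> \<phi> ` (U \<inter> V) \<Longrightarrow> (g \<circ> inv_into V \<alpha>) ((\<alpha> \<circ> inv_into U \<phi>) y) = (g \<circ> inv_into U \<phi>) y"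
    using inv by auto
qed

text \<open>Both claims are local, so near each point they are transported from an atlas chart
  through the smooth transition map.\<close>

lemma smooth_map_coordinates:
  assumes g: "smooth_map A g"
  shows "\<And>y. y \<in> \<alpha> ` V \<Longrightarrow> (g \<circ> inv_into V \<alpha>) differentiable (at y)"
    and "continuous_on (\<alpha> ` V) (partial i (g \<circ> inv_into V \<alpha>))"
proof -
  have local: "(g \<circ> inv_into V \<alpha>) differentiable (at y) \<and>
      continuous (at y) (partial i (g \<circ> inv_into V \<alpha>))" if y: "y \<in> \<alpha> ` V" for y
  proof -
    obtain q where q: "q \<in> V" "y = \<alpha> q" using y by auto
    obtain U \<phi> where c: "(U, \<phi>) \<in> A" "q \<in> U" by (rule oriented_atlas_cover[OF atlas])
    have G: "smooth_on (\<phi> ` U) (g \<circ> inv_into U \<phi>)"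
      using g c(1) by (auto simp: smooth_map_def)
    let ?T = "\<alpha> ` (U \<inter> V)"
    note inv = open_embeddingD(6)[OF oriented_atlas_chart[OF atlas c(1)]]
      open_embeddingD(6)[OF coordinates_embedding]
    have T: "open ?T" "\<And>z. z \<in> ?T \<Longrightarrow> (g \<circ> inv_into V \<alpha>) differentiable (at z)"
    proof -
      show "open ?T" using transition_open[OF c(1)] by simp
      fix z assume "z \<in> ?T"
      then obtain r where r: "r \<in> U" "r \<in> V" "z = \<alpha> r" by auto
      obtain J K where K: "((\<phi> \<circ> inv_into V \<alpha>) has_derivative K) (at (\<alpha> r))"
        by (rule transition_derivative[OF c(1) r(1,2)])
      from chart_to_coordinates[OF c(1) r(1,2) K smooth_on_has_derivative[OF G]] r(1)
      show "(g \<circ> inv_into V \<alpha>) differentiable (at z)"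
        unfolding r(3) by (blast intro: differentiableI)
    qed
    have "partial i ((g \<circ> inv_into U \<phi>) \<circ> (\<phi> \<circ> inv_into V \<alpha>)) z = partial i (g \<circ> inv_into V \<alpha>) z"
      if "z \<in> ?T" for z
      by (rule partial_transform_open[OF T(1) that _ T(2)[OF that]]) (use inv in auto)
    moreover have "continuous_on ?T (partial i ((g \<circ> inv_into U \<phi>) \<circ> (\<phi> \<circ> inv_into V \<alpha>)))"
      by (rule continuous_on_partial_compose[OF transition_smooth(2)[OF c(1)] G]) (use inv in auto)
    ultimately have "continuous_on ?T (partial i (g \<circ> inv_into V \<alpha>))"
      using continuous_on_eq by blast
    then show ?thesis
      using T q c by (auto simp: continuous_on_eq_continuous_at)
  qed
  then show "\<And>y. y \<in> \<alpha> ` V \<Longrightarrow> (g \<circ> inv_into V \<alpha>) differentiable (at y)" by blast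
  show "continuous_on (\<alpha> ` V) (partial i (g \<circ> inv_into V \<alpha>))"
    using local by (intro continuous_at_imp_continuous_on) auto
qed

end

section \<open>The model cuspidal edge\<close>

lemma standard_cuspidal_edge_eq:
  "standard_cuspidal_edge x = (x $ 1)\<^sup>2 *\<^sub>R axis 1 1 + (x $ 1)^3 *\<^sub>R axis 2 1 + x $ 2 *\<^sub>R axis 3 1"
  by (simp add: standard_cuspidal_edge_def vec_eq_iff forall_3 axis_def)

lemma standard_cuspidal_edge_has_derivative:
  "(standard_cuspidal_edge has_derivative
     (\<lambda>h. (2 * x $ 1 * h $ 1) *\<^sub>R axis 1 1 + (3 * (x $ 1)\<^sup>2 * h $ 1) *\<^sub>R axis 2 1 + h $ 2 *\<^sub>R axis 3 1)) (at x)"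
  unfolding standard_cuspidal_edge_eq[abs_def]
  by (auto intro!: derivative_eq_intros bounded_linear_imp_has_derivative simp: algebra_simps power2_eq_square)

lemma continuous_on_standard_cuspidal_edge: "continuous_on S standard_cuspidal_edge"
  unfolding standard_cuspidal_edge_eq[abs_def] by (intro continuous_intros)

section \<open>Adapted coordinates at a cuspidal edge\<close>

text \<open>The coefficient is a determinant: cross products of partial derivatives pick up the
  Jacobian of a coordinate change.\<close>

lemma cross3_linear_combinations:
  "cross3 (p *\<^sub>R a + q *\<^sub>R b) (r *\<^sub>R a + s *\<^sub>R b) = (p * s - q * r) *\<^sub>R cross3 a b"
  by (simp add: cross_add_left cross_add_right cross_mult_left cross_mult_right cross_skew[of b a]
      algebra_simps)

lemma cross3_nonzero_independent:
  assumes "cross3 a b \<noteq> 0" "s *\<^sub>R a + t *\<^sub>R b = 0"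
  shows "s = 0" "t = 0"
  using assms cross3_linear_combinations[of s a t b 0 1] cross3_linear_combinations[of 1 a 0 b s t]
  by auto

text \<open>Differentiating the orthogonality of f_*X and \<open>\<nu>\<close> in direction Y shows
  that h(X,Y) is the normal component of the second derivative of \<open>f\<close>, which is
  symmetric. The argument holds at singular points too.\<close>

lemma second_fundamental_form_symmetric:
  assumes atlas: "oriented_atlas A" and front: "front A f \<nu>" and c: "c \<in> A" "q \<in> fst c"
  shows "push c f q X \<bullet> push c \<nu> q Y = push c f q Y \<bullet> push c \<nu> q X"
proof -
  obtain U \<phi> where U: "c = (U, \<phi>)" by (cases c)
  let ?F = "f \<circ> inv_into U \<phi>" and ?N = "\<nu> \<circ> inv_into U \<phi>" and ?S = "\<phi> ` U"
  note emb = oriented_atlas_chart[OF atlas c(1)[unfolded U]]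
  have F: "smooth_on ?S ?F" and N: "smooth_on ?S ?N"
    using front c U by (auto simp: front_def smooth_map_def)
  have S: "open ?S" "\<phi> q \<in> ?S"
    using open_embeddingD(2)[OF emb] c U by auto
  have normal: "frechet_derivative ?F (at y) Z \<bullet> ?N y = 0" if y: "y \<in> ?S" for y Z
  proof -
    obtain r where r: "r \<in> U" "y = \<phi> r" using y by auto
    have "push c f r Z \<bullet> \<nu> r = 0" using front c(1) r(1) U by (auto simp: front_def)
    then show ?thesis using open_embeddingD(6)[OF emb] r by (simp add: push_def U)
  qed
  have "frechet_derivative (\<lambda>y. frechet_derivative ?F (at y) Z) (at (\<phi> q)) W \<bullet> ?N (\<phi> q)
      + frechet_derivative ?F (at (\<phi> q)) Z \<bullet> frechet_derivative ?N (at (\<phi> q)) W = 0" for Z W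
  proof -
    have d1: "((\<lambda>y. frechet_derivative ?F (at y) Z \<bullet> ?N y) has_derivative
      (\<lambda>W. frechet_derivative ?F (at (\<phi> q)) Z \<bullet> frechet_derivative ?N (at (\<phi> q)) W
        + frechet_derivative (\<lambda>y. frechet_derivative ?F (at y) Z) (at (\<phi> q)) W \<bullet> ?N (\<phi> q))) (at (\<phi> q))"
      by (intro has_derivative_inner smooth_on_has_derivative[OF _ S(2)] smooth_on_frechet_derivative F N)
    have d2: "((\<lambda>y. frechet_derivative ?F (at y) Z \<bullet> ?N y) has_derivative (\<lambda>W. 0)) (at (\<phi> q))"
      by (rule has_derivative_transform_within_open[OF has_derivative_const[of 0] S]) (simp only: normal)
    show ?thesis
      using fun_cong[OF has_derivative_unique[OF d1 d2], of W] by (simp only: add.commute)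
  qed
  from this[of X Y] this[of Y X] second_derivative_symmetric[OF S F, of X Y]
  show ?thesis
    by (simp add: push_def U)
qed

text \<open>Here \<open>a\<close> extends the quotient f_u / u across the singular set, where the
  derivative of \<open>f\<close> alone does not determine it, so it is recorded as data;
  \<open>b\<close>, \<open>n1\<close>, \<open>n2\<close> are f_v and the two partials of
  \<open>\<nu>\<close>. Tangency of \<open>a\<close> is not postulated but derived.\<close>

locale cuspidal_coordinates =
  fixes A :: "'m::{t2_space,second_countable_topology} chart set" and f \<nu> :: "'m \<Rightarrow> real^3" and p :: 'm
    and V :: "'m set" and \<alpha> :: "'m \<Rightarrow> real^2" and a b n1 n2 :: "real^2 \<Rightarrow> real^3"
  assumes atlas: "oriented_atlas A" and front: "front A f \<nu>"
    and coord: "surface_diffeo A V \<alpha>" and p: "p \<in> V" "\<alpha> p = 0"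
    and continuous_frame: "continuous_on (\<alpha> ` V) a" "continuous_on (\<alpha> ` V) b"
      "continuous_on (\<alpha> ` V) n1" "continuous_on (\<alpha> ` V) n2"
    and derivative_f: "\<And>y. y \<in> \<alpha> ` V \<Longrightarrow>
      ((f \<circ> inv_into V \<alpha>) has_derivative (\<lambda>X. (X $ 1 * y $ 1) *\<^sub>R a y + X $ 2 *\<^sub>R b y)) (at y)"
    and derivative_\<nu>: "\<And>y. y \<in> \<alpha> ` V \<Longrightarrow>
      ((\<nu> \<circ> inv_into V \<alpha>) has_derivative (\<lambda>X. X $ 1 *\<^sub>R n1 y + X $ 2 *\<^sub>R n2 y)) (at y)"
    and independent: "\<And>y. y \<in> \<alpha> ` V \<Longrightarrow> cross3 (a y) (b y) \<noteq> 0"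

lemma cuspidal_coordinates_exist:
  assumes atlas: "oriented_atlas A" and front: "front A f \<nu>" and edge: "cuspidal_edge A f p"
  shows "\<exists>V \<alpha> a b n1 n2. cuspidal_coordinates A f \<nu> p V \<alpha> a b n1 n2"
proof -
  obtain V \<alpha> W and \<beta> :: "real^3 \<Rightarrow> real^3" where p: "p \<in> V" "\<alpha> p = 0" and coord: "surface_diffeo A V \<alpha>"
    and W: "f ` V \<subseteq> W" "euclidean_diffeo W \<beta>"
    and normal_form: "\<And>q. q \<in> V \<Longrightarrow> \<beta> (f q) = standard_cuspidal_edge (\<alpha> q)"
    using edge unfolding cuspidal_edge_def by blast
  define B where "B = inv_into W \<beta>"
  have emb: "open_embedding W \<beta>" and smooth: "smooth_on W \<beta>" "smooth_on (\<beta> ` W) B"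
    using W(2) by (auto simp: euclidean_diffeo_def B_def)
  define B' where "B' y = frechet_derivative B (at (standard_cuspidal_edge y))" for y
  have image: "standard_cuspidal_edge y \<in> \<beta> ` W" if "y \<in> \<alpha> ` V" for y
    using that normal_form W(1) by force
  have B: "(B has_derivative B' y) (at (standard_cuspidal_edge y))" if "y \<in> \<alpha> ` V" for y
    unfolding B'_def by (rule smooth_on_has_derivative[OF smooth(2) image[OF that]])
  have lin: "linear (B' y)" if "y \<in> \<alpha> ` V" for y
    using has_derivative_linear[OF B[OF that]] .
  \<comment> \<open>On its domain \<open>B\<close> is followed by its left inverse
    \<open>\<beta>\<close>, so its derivative has a left inverse.\<close>
  have inj: "v = w" if y: "y \<in> \<alpha> ` V" and "B' y v = B' y w" for y v w
  proof -
    have B_in: "B (standard_cuspidal_edge y) \<in> W"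
      unfolding B_def by (rule inv_into_into[OF image[OF y]])
    have "frechet_derivative \<beta> (at (B (standard_cuspidal_edge y))) (B' y u) = u" for u
      by (rule left_inverse_derivative[OF B[OF y] smooth_on_has_derivative[OF smooth(1) B_in]
            open_embeddingD(2)[OF emb] image[OF y]]) (simp add: B_def f_inv_into_f)
    then show "v = w" using that by metis
  qed
  \<comment> \<open>The chain rule for B(u^2, u^3, v) gives f_u = 2u B'e_1 + 3u^2 B'e_2; this is
    what remains after division by u, and its first term keeps it nonzero at u = 0.\<close>
  define a where "a y = 2 *\<^sub>R B' y (axis 1 1) + (3 * y $ 1) *\<^sub>R B' y (axis 2 1)" for y :: "real^2"
  define b where "b y = B' y (axis 3 1)" for y :: "real^2"
  have contB: "continuous_on (\<alpha> ` V) (\<lambda>y. B' y v)" for v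
    unfolding B'_def
    by (rule continuous_on_compose2[OF smooth_on_continuous_on[OF smooth_on_frechet_derivative[OF smooth(2)]]
          continuous_on_standard_cuspidal_edge]) (use image in auto)
  have "cross3 (a y) (b y) \<noteq> 0" if y: "y \<in> \<alpha> ` V" for y
  proof
    assume "cross3 (a y) (b y) = 0"
    then have "a y = 0 \<or> b y = 0 \<or> (\<exists>c. b y = c *\<^sub>R a y)"
      by (simp add: cross_eq_0 collinear_lemma)
    moreover have a: "a y = B' y (2 *\<^sub>R axis 1 1 + (3 * y $ 1) *\<^sub>R axis 2 1)"
      by (simp add: a_def linear_add[OF lin[OF y]] linear_scale[OF lin[OF y]])
    moreover have "a y \<noteq> 0"
      using inj[OF y, of "2 *\<^sub>R axis 1 1 + (3 * y $ 1) *\<^sub>R axis 2 1" 0] linear_0[OF lin[OF y]] a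
      by (auto simp: vec_eq_iff forall_3 axis_def)
    moreover have "b y \<noteq> 0"
      using inj[OF y, of "axis 3 1" 0] linear_0[OF lin[OF y]]
      by (auto simp: b_def axis_eq_0_iff)
    ultimately obtain c where "B' y (axis 3 1) = B' y (c *\<^sub>R (2 *\<^sub>R axis 1 1 + (3 * y $ 1) *\<^sub>R axis 2 1))"
      by (auto simp: b_def linear_scale[OF lin[OF y]])
    from inj[OF y this] show False
      by (auto simp: vec_eq_iff forall_3 axis_def)
  qed
  moreover have "((f \<circ> inv_into V \<alpha>) has_derivative (\<lambda>X. (X $ 1 * y $ 1) *\<^sub>R a y + X $ 2 *\<^sub>R b y)) (at y)"
    if y: "y \<in> \<alpha> ` V" for y
  proof (rule has_derivative_transform_within_open)
    note emb\<alpha> = coordinates_embedding[OF atlas coord]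
    show "((\<lambda>y. B (standard_cuspidal_edge y)) has_derivative (\<lambda>X. (X $ 1 * y $ 1) *\<^sub>R a y + X $ 2 *\<^sub>R b y)) (at y)"
      using has_derivative_compose[OF standard_cuspidal_edge_has_derivative B[OF y]]
      by (simp add: linear_add[OF lin[OF y]] linear_scale[OF lin[OF y]] a_def b_def
          algebra_simps power2_eq_square)
    show "open (\<alpha> ` V)" using open_embeddingD(2)[OF emb\<alpha>] .
    show "y \<in> \<alpha> ` V" by fact
    show "B (standard_cuspidal_edge y) = (f \<circ> inv_into V \<alpha>) y" if "y \<in> \<alpha> ` V" for y
      using that normal_form W(1) open_embeddingD(6)[OF emb\<alpha>] open_embeddingD(6)[OF emb]
      by (force simp: B_def normal_form[symmetric])
  qed
  moreover have "((\<nu> \<circ> inv_into V \<alpha>) has_derivative (\<lambda>X. X $ 1 *\<^sub>R partial 1 (\<nu> \<circ> inv_into V \<alpha>) y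
      + X $ 2 *\<^sub>R partial 2 (\<nu> \<circ> inv_into V \<alpha>) y)) (at y)" if "y \<in> \<alpha> ` V" for y
    using front smooth_map_coordinates(1)[OF atlas coord _ that, of \<nu>]
    by (intro has_derivative_partials) (auto simp: front_def)
  moreover have "continuous_on (\<alpha> ` V) (partial i (\<nu> \<circ> inv_into V \<alpha>))" for i
    using front smooth_map_coordinates(2)[OF atlas coord] by (auto simp: front_def)
  moreover have "continuous_on (\<alpha> ` V) a" "continuous_on (\<alpha> ` V) b"
    unfolding a_def b_def by (intro continuous_intros contB)+
  ultimately have "cuspidal_coordinates A f \<nu> p V \<alpha> a b
      (partial 1 (\<nu> \<circ> inv_into V \<alpha>)) (partial 2 (\<nu> \<circ> inv_into V \<alpha>))"
    by (intro cuspidal_coordinates.intro atlas front coord p) auto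
  then show ?thesis by blast
qed

context cuspidal_coordinates
begin

lemma embedding: "open_embedding V \<alpha>"
  using coordinates_embedding[OF atlas coord] .

lemma inverse_coordinates: "q \<in> V \<Longrightarrow> inv_into V \<alpha> (\<alpha> q) = q"
  using open_embeddingD(6)[OF embedding] .

text \<open>Singular points, fronts and the second fundamental form are defined through atlas
  charts. \<open>J\<close> rewrites their push-forwards in the frame, and
  \<open>K (axis i 1)\<close> represents the i-th coordinate vector of \<open>\<alpha>\<close> in
  the chart.\<close>

lemma chart_derivatives:
  assumes "(U, \<phi>) \<in> A" "q \<in> U" "q \<in> V"
  obtains J K :: "real^2 \<Rightarrow> real^2" where "((\<alpha> \<circ> inv_into U \<phi>) has_derivative J) (at (\<phi> q))" "linear J" "linear K" "\<And>X. J (K X) = X" "\<And>X. K (J X) = X"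
    "\<And>X. push (U, \<phi>) f q X = (J X $ 1 * \<alpha> q $ 1) *\<^sub>R a (\<alpha> q) + J X $ 2 *\<^sub>R b (\<alpha> q)"
    "\<And>X. push (U, \<phi>) \<nu> q X = J X $ 1 *\<^sub>R n1 (\<alpha> q) + J X $ 2 *\<^sub>R n2 (\<alpha> q)"
proof -
  obtain J K where J: "((\<alpha> \<circ> inv_into U \<phi>) has_derivative J) (at (\<phi> q))"
    and K: "((\<phi> \<circ> inv_into V \<alpha>) has_derivative K) (at (\<alpha> q))"
    and inv: "\<And>X. J (K X) = X" "\<And>X. K (J X) = X"
    by (rule transition_derivative[OF atlas coord assms]) blast
  have q: "\<alpha> q \<in> \<alpha> ` V" using assms by auto
  show thesis
    by (rule that[OF J has_derivative_linear[OF J] has_derivative_linear[OF K] inv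
          push_eq[OF coordinates_to_chart[OF atlas coord assms J derivative_f[OF q]]]
          push_eq[OF coordinates_to_chart[OF atlas coord assms J derivative_\<nu>[OF q]]]])
qed

text \<open>The partials of \<open>f\<close> are u a and b. For u = 0 the first coordinate vector is
  annihilated; otherwise independence of a and b makes the derivative injective.\<close>

lemma singular_iff:
  assumes "q \<in> V"
  shows "q \<in> singular_set A f \<longleftrightarrow> \<alpha> q $ 1 = 0"
proof
  assume "\<alpha> q $ 1 = 0"
  obtain U \<phi> where c: "(U, \<phi>) \<in> A" "q \<in> U" by (rule oriented_atlas_cover[OF atlas])
  obtain J K :: "real^2 \<Rightarrow> real^2" where lin: "linear J" and JK: "\<And>X. J (K X) = X"
    and push: "\<And>X. push (U, \<phi>) f q X = (J X $ 1 * \<alpha> q $ 1) *\<^sub>R a (\<alpha> q) + J X $ 2 *\<^sub>R b (\<alpha> q)"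
    by (rule chart_derivatives[OF c assms]) blast
  have "push (U, \<phi>) f q (K (axis 1 1)) = push (U, \<phi>) f q 0"
    unfolding push using \<open>\<alpha> q $ 1 = 0\<close> linear_0[OF lin] by (simp add: JK) (simp add: axis_def)
  moreover have "K (axis 1 1) \<noteq> 0"
    using JK[of "axis 1 1"] linear_0[OF lin] by (auto simp: axis_eq_0_iff)
  ultimately have "\<not> inj (push (U, \<phi>) f q)" by (metis injD)
  then show "q \<in> singular_set A f"
    using c unfolding singular_set_def immersion_at_def by force
next
  assume sing: "q \<in> singular_set A f"
  show "\<alpha> q $ 1 = 0"
  proof (rule ccontr)
    assume u: "\<alpha> q $ 1 \<noteq> 0"
    have "inj (push (U, \<phi>) f q)" if c: "(U, \<phi>) \<in> A" "q \<in> U" for U \<phi>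
    proof (rule injI)
      fix X Y assume eq: "push (U, \<phi>) f q X = push (U, \<phi>) f q Y"
      obtain J K :: "real^2 \<Rightarrow> real^2" where KJ: "\<And>X. K (J X) = X"
        and push: "\<And>X. push (U, \<phi>) f q X = (J X $ 1 * \<alpha> q $ 1) *\<^sub>R a (\<alpha> q) + J X $ 2 *\<^sub>R b (\<alpha> q)"
    by (rule chart_derivatives[OF c assms]) blast
      have "((J X $ 1 - J Y $ 1) * \<alpha> q $ 1) *\<^sub>R a (\<alpha> q) + (J X $ 2 - J Y $ 2) *\<^sub>R b (\<alpha> q) = 0"
        using eq unfolding push by (simp add: algebra_simps)
      from cross3_nonzero_independent[OF independent this] u assms
      have "J X = J Y" by (auto simp: vec_eq_iff forall_2)
      then show "X = Y" by (metis KJ)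
    qed
    then have "immersion_at A f q" by (auto simp: immersion_at_def)
    with sing show False by (simp add: singular_set_def)
  qed
qed

text \<open>The curvature is evaluated in a chart picked by choice, about which only membership in
  the atlas is known. With d the determinant of \<open>J\<close>, the cross products of the
  derivatives of \<open>f\<close> and \<open>\<nu>\<close> acquire the factors d u and d, so the
  quotient is multiplied by d u d / (d u)^2 = 1/u, whatever the chart.\<close>

lemma gaussian_curvature_eq:
  assumes q: "q \<in> V" and u: "\<alpha> q $ 1 \<noteq> 0"
  shows "gaussian_curvature A f q =
    (cross3 (a (\<alpha> q)) (b (\<alpha> q)) \<bullet> cross3 (n1 (\<alpha> q)) (n2 (\<alpha> q)))
      / (norm (cross3 (a (\<alpha> q)) (b (\<alpha> q))))\<^sup>2 / \<alpha> q $ 1"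
proof -
  define c where "c = (SOME c. c \<in> A \<and> q \<in> fst c)"
  obtain U' \<phi>' where "(U', \<phi>') \<in> A" "q \<in> U'" by (rule oriented_atlas_cover[OF atlas])
  then have "\<exists>c. c \<in> A \<and> q \<in> fst c" by force
  then have "c \<in> A \<and> q \<in> fst c" unfolding c_def by (rule someI_ex)
  moreover obtain U \<phi> where U: "c = (U, \<phi>)" by (cases c)
  ultimately have c: "(U, \<phi>) \<in> A" "q \<in> U" by auto
  note emb = oriented_atlas_chart[OF atlas c(1)]
  define F where "F = f \<circ> inv_into U \<phi>"
  define N where "N = \<nu> \<circ> inv_into U \<phi>"
  obtain J K :: "real^2 \<Rightarrow> real^2" where lin: "linear K" "linear J" and JK: "\<And>X. J (K X) = X"
    and push: "\<And>X. push (U, \<phi>) f q X = (J X $ 1 * \<alpha> q $ 1) *\<^sub>R a (\<alpha> q) + J X $ 2 *\<^sub>R b (\<alpha> q)"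
      "\<And>X. push (U, \<phi>) \<nu> q X = J X $ 1 *\<^sub>R n1 (\<alpha> q) + J X $ 2 *\<^sub>R n2 (\<alpha> q)"
    by (rule chart_derivatives[OF c q]) blast
  define d where "d = J (axis 1 1) $ 1 * J (axis 2 1) $ 2 - J (axis 1 1) $ 2 * J (axis 2 1) $ 1"
  have d: "d \<noteq> 0"
  proof
    assume "d = 0"
    have J: "J X = X $ 1 *\<^sub>R J (axis 1 1) + X $ 2 *\<^sub>R J (axis 2 1)" for X
      using linear_on_real2[OF lin(2)] .
    \<comment> \<open>\<open>J\<close> maps these two vectors to the standard basis, so the left
      side of the next identity is 1, whereas \<open>d = 0\<close> would make its right side
      0.\<close>
    define X Y where "X = K (axis 1 1)" and "Y = K (axis 2 1)"
    have "J X $ 1 * J Y $ 2 - J X $ 2 * J Y $ 1 = d * (X $ 1 * Y $ 2 - X $ 2 * Y $ 1)"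
      unfolding J[of X] J[of Y] d_def by (simp add: algebra_simps)
    with \<open>d = 0\<close> show False
      by (simp add: X_def Y_def JK) (simp add: axis_def)
  qed
  have partial: "partial i F (\<phi> q) = push (U, \<phi>) f q (axis i 1)"
    "partial i N (\<phi> q) = push (U, \<phi>) \<nu> q (axis i 1)" for i
    by (simp_all add: partial_def push_def F_def N_def)
  have "cross3 (partial 1 F (\<phi> q)) (partial 2 F (\<phi> q)) = (d * \<alpha> q $ 1) *\<^sub>R cross3 (a (\<alpha> q)) (b (\<alpha> q))"
    unfolding partial push cross3_linear_combinations d_def by (simp add: algebra_simps)
  moreover have "cross3 (partial 1 N (\<phi> q)) (partial 2 N (\<phi> q)) = d *\<^sub>R cross3 (n1 (\<alpha> q)) (n2 (\<alpha> q))"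
    unfolding partial push cross3_linear_combinations d_def by (simp add: algebra_simps)
  moreover have "metric_curvature (\<lambda>y. \<chi> i j. partial i F y \<bullet> partial j F y) (\<phi> q) =
      (cross3 (partial 1 F (\<phi> q)) (partial 2 F (\<phi> q)) \<bullet> cross3 (partial 1 N (\<phi> q)) (partial 2 N (\<phi> q)))
      / (norm (cross3 (partial 1 F (\<phi> q)) (partial 2 F (\<phi> q))))\<^sup>2"
  proof (rule theorema_egregium)
    show "open (\<phi> ` U)" using open_embeddingD(2)[OF emb] .
    show "\<phi> q \<in> \<phi> ` U" using c by auto
    show "smooth_on (\<phi> ` U) F" "smooth_on (\<phi> ` U) N"
      using front c by (auto simp: front_def smooth_map_def F_def N_def)
    show "norm (N (\<phi> q)) = 1" using front by (auto simp: front_def N_def)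
    show "partial i F y \<bullet> N y = 0" if y: "y \<in> \<phi> ` U" for y i
    proof -
      obtain r where r: "r \<in> U" "y = \<phi> r" using y by auto
      have "push (U, \<phi>) f r (axis i 1) \<bullet> \<nu> r = 0"
        using front c(1) r(1) unfolding front_def by (metis fst_conv)
      then show ?thesis
        using open_embeddingD(6)[OF emb] r by (simp add: push_def F_def N_def partial_def)
    qed
    show "cross3 (partial 1 F (\<phi> q)) (partial 2 F (\<phi> q)) \<noteq> 0"
      unfolding calculation(1) using d u independent q by simp
  qed
  moreover have "gaussian_curvature A f q =
      metric_curvature (\<lambda>y. \<chi> i j. partial i F y \<bullet> partial j F y) (\<phi> q)"
    unfolding gaussian_curvature_def Let_def c_def[symmetric] U
    by (simp add: pullback_metric_def[abs_def] F_def)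
  ultimately have "gaussian_curvature A f q =
      (d * \<alpha> q $ 1) * d * (cross3 (a (\<alpha> q)) (b (\<alpha> q)) \<bullet> cross3 (n1 (\<alpha> q)) (n2 (\<alpha> q)))
        / ((d * \<alpha> q $ 1)\<^sup>2 * (norm (cross3 (a (\<alpha> q)) (b (\<alpha> q))))\<^sup>2)"
    by (simp add: power_mult_distrib)
  then show ?thesis
    using d u by (simp add: power2_eq_square)
qed

end

section \<open>The curvature near a generic cuspidal edge\<close>

context cuspidal_coordinates
begin

section \<open>Orthogonality relations at the cuspidal edge\<close>

lemma zero_in_image: "0 \<in> \<alpha> ` V"
  using p by force

lemma b_tangent:
  assumes "q \<in> V"
  shows "b (\<alpha> q) \<bullet> \<nu> q = 0"
proof -
  obtain U \<phi> where c: "(U, \<phi>) \<in> A" "q \<in> U" by (rule oriented_atlas_cover[OF atlas])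
  obtain J K :: "real^2 \<Rightarrow> real^2" where JK: "\<And>X. J (K X) = X"
    and push: "\<And>X. push (U, \<phi>) f q X = (J X $ 1 * \<alpha> q $ 1) *\<^sub>R a (\<alpha> q) + J X $ 2 *\<^sub>R b (\<alpha> q)"
    by (rule chart_derivatives[OF c assms]) blast
  have "push (U, \<phi>) f q (K (axis 2 1)) \<bullet> \<nu> q = 0"
    using front c unfolding front_def by (metis fst_conv)
  then show ?thesis
    unfolding push JK by (simp add: axis_def)
qed

lemma a_tangent_regular:
  assumes "q \<in> V" "\<alpha> q $ 1 \<noteq> 0"
  shows "a (\<alpha> q) \<bullet> \<nu> q = 0"
proof -
  obtain U \<phi> where c: "(U, \<phi>) \<in> A" "q \<in> U" by (rule oriented_atlas_cover[OF atlas])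
  obtain J K :: "real^2 \<Rightarrow> real^2" where JK: "\<And>X. J (K X) = X"
    and push: "\<And>X. push (U, \<phi>) f q X = (J X $ 1 * \<alpha> q $ 1) *\<^sub>R a (\<alpha> q) + J X $ 2 *\<^sub>R b (\<alpha> q)"
    by (rule chart_derivatives[OF c assms(1)]) blast
  have "push (U, \<phi>) f q (K (axis 1 1)) \<bullet> \<nu> q = 0"
    using front c unfolding front_def by (metis fst_conv)
  then show ?thesis
    unfolding push JK using assms(2) by (simp add: axis_def)
qed

text \<open>At \<open>p\<close> itself f_u = 0 says nothing about \<open>a\<close>. The relation
  holds at regular points, which accumulate at \<open>p\<close>, and passes to the limit by
  continuity.\<close>

lemma a_tangent: "a 0 \<bullet> \<nu> p = 0"
proof (rule ccontr)
  assume ne: "a 0 \<bullet> \<nu> p \<noteq> 0"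
  define g where "g y = a y \<bullet> (\<nu> \<circ> inv_into V \<alpha>) y" for y
  have op: "open (\<alpha> ` V)" using open_embeddingD(2)[OF embedding] .
  have "isCont a 0"
    using continuous_frame(1) zero_in_image unfolding continuous_on_eq_continuous_at[OF op] by blast
  moreover have "isCont (\<nu> \<circ> inv_into V \<alpha>) 0"
    using derivative_\<nu>[OF zero_in_image] has_derivative_continuous by blast
  ultimately have "isCont g 0"
    unfolding g_def by (rule continuous_inner)
  moreover have "g 0 \<noteq> 0"
    using ne inverse_coordinates[OF p(1)] p(2) by (simp add: g_def)
  ultimately have "\<forall>\<^sub>F y in at 0. g y \<noteq> 0"
    unfolding isCont_def by (rule tendsto_imp_eventually_ne)
  moreover have "\<forall>\<^sub>F y in at 0. y \<in> \<alpha> ` V"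
    using op zero_in_image by (rule eventually_at_in_open')
  ultimately have "\<forall>\<^sub>F y in at 0. g y \<noteq> 0 \<and> y \<in> \<alpha> ` V" by (rule eventually_conj)
  then obtain d where d: "d > 0" "\<And>y. y \<noteq> 0 \<Longrightarrow> dist y 0 < d \<Longrightarrow> g y \<noteq> 0 \<and> y \<in> \<alpha> ` V"
    unfolding eventually_at by auto
  \<comment> \<open>A point on the u-axis other than the origin is regular, and at distance d/2 it
    lies where \<open>g\<close> is nonzero.\<close>
  define y :: "real^2" where "y = (d / 2) *\<^sub>R axis 1 1"
  have "y \<noteq> 0" "dist y 0 < d" using d(1) by (auto simp: y_def axis_eq_0_iff)
  with d(2) have y: "g y \<noteq> 0" "y \<in> \<alpha> ` V" by auto
  then obtain q where q: "q \<in> V" "y = \<alpha> q" by auto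
  have "\<alpha> q $ 1 \<noteq> 0" using d(1) q(2)[symmetric] by (simp add: y_def axis_def)
  from a_tangent_regular[OF q(1) this] y(1) show False
    using q inverse_coordinates by (simp add: g_def)
qed

lemma n1_tangent: "n1 0 \<bullet> \<nu> p = 0"
proof -
  let ?N = "\<nu> \<circ> inv_into V \<alpha>"
  have "((\<lambda>y. ?N y \<bullet> ?N y) has_derivative
      (\<lambda>X. ?N 0 \<bullet> (X $ 1 *\<^sub>R n1 0 + X $ 2 *\<^sub>R n2 0) + (X $ 1 *\<^sub>R n1 0 + X $ 2 *\<^sub>R n2 0) \<bullet> ?N 0)) (at 0)"
    by (intro has_derivative_inner derivative_\<nu> zero_in_image)
  moreover have "?N y \<bullet> ?N y = 1" for y
    using front by (simp add: front_def dot_square_norm)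
  ultimately have "((\<lambda>y. 1::real) has_derivative
      (\<lambda>X. ?N 0 \<bullet> (X $ 1 *\<^sub>R n1 0 + X $ 2 *\<^sub>R n2 0) + (X $ 1 *\<^sub>R n1 0 + X $ 2 *\<^sub>R n2 0) \<bullet> ?N 0)) (at (0::real^2))"
    by (simp only:)
  from fun_cong[OF has_derivative_unique[OF this has_derivative_const], of "axis 1 1"]
  show ?thesis
    using inverse_coordinates[OF p(1)] p(2) by (simp add: axis_def inner_commute)
qed

lemma b_n1: "b 0 \<bullet> n1 0 = 0"
proof -
  obtain U \<phi> where c: "(U, \<phi>) \<in> A" "p \<in> U" by (rule oriented_atlas_cover[OF atlas])
  obtain J K :: "real^2 \<Rightarrow> real^2" where JK: "\<And>X. J (K X) = X"
    and push: "\<And>X. push (U, \<phi>) f p X = (J X $ 1 * \<alpha> p $ 1) *\<^sub>R a (\<alpha> p) + J X $ 2 *\<^sub>R b (\<alpha> p)"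
      "\<And>X. push (U, \<phi>) \<nu> p X = J X $ 1 *\<^sub>R n1 (\<alpha> p) + J X $ 2 *\<^sub>R n2 (\<alpha> p)"
    by (rule chart_derivatives[OF c p(1)]) blast
  have "push (U, \<phi>) f p (K (axis 2 1)) \<bullet> push (U, \<phi>) \<nu> p (K (axis 1 1))
      = push (U, \<phi>) f p (K (axis 1 1)) \<bullet> push (U, \<phi>) \<nu> p (K (axis 2 1))"
    using second_fundamental_form_symmetric[OF atlas front] c by simp
  then show ?thesis
    unfolding push JK p by (simp add: axis_def)
qed

text \<open>At \<open>p\<close> the u-derivative of \<open>f\<close> vanishes. If that of
  \<open>\<nu>\<close> vanished as well, \<open>K (axis 1 1)\<close> would be a nonzero kernel
  vector of the derivative of \<open>(f, \<nu>)\<close>.\<close>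

lemma n1_nonzero: "n1 0 \<noteq> 0"
proof
  assume zero: "n1 0 = 0"
  obtain U \<phi> where c: "(U, \<phi>) \<in> A" "p \<in> U" by (rule oriented_atlas_cover[OF atlas])
  obtain J K :: "real^2 \<Rightarrow> real^2" where lin: "linear J" and JK: "\<And>X. J (K X) = X"
    and push: "\<And>X. push (U, \<phi>) f p X = (J X $ 1 * \<alpha> p $ 1) *\<^sub>R a (\<alpha> p) + J X $ 2 *\<^sub>R b (\<alpha> p)"
      "\<And>X. push (U, \<phi>) \<nu> p X = J X $ 1 *\<^sub>R n1 (\<alpha> p) + J X $ 2 *\<^sub>R n2 (\<alpha> p)"
    by (rule chart_derivatives[OF c p(1)]) blast
  have "push (U, \<phi>) (\<lambda>q. (f q, \<nu> q)) p X = (push (U, \<phi>) f p X, push (U, \<phi>) \<nu> p X)" for X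
  proof -
    have F: "smooth_on (\<phi> ` U) (f \<circ> inv_into U \<phi>)" and N: "smooth_on (\<phi> ` U) (\<nu> \<circ> inv_into U \<phi>)"
      using front c by (auto simp: front_def smooth_map_def)
    have "((\<lambda>y. ((f \<circ> inv_into U \<phi>) y, (\<nu> \<circ> inv_into U \<phi>) y)) has_derivative
        (\<lambda>X. (push (U, \<phi>) f p X, push (U, \<phi>) \<nu> p X))) (at (\<phi> p))"
      unfolding push_def fst_conv snd_conv
      using c(2) by (intro has_derivative_Pair smooth_on_has_derivative[OF F] smooth_on_has_derivative[OF N]) auto
    then have "((\<lambda>q. (f q, \<nu> q)) \<circ> inv_into U \<phi> has_derivative
        (\<lambda>X. (push (U, \<phi>) f p X, push (U, \<phi>) \<nu> p X))) (at (\<phi> p))"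
      by (simp add: o_def)
    then show ?thesis by (rule push_eq)
  qed
  then have eq: "push (U, \<phi>) (\<lambda>q. (f q, \<nu> q)) p (K (axis 1 1)) = push (U, \<phi>) (\<lambda>q. (f q, \<nu> q)) p 0"
    by (simp add: push JK p zero linear_0[OF lin]) (simp add: axis_def)
  have "\<forall>p. immersion_at A (\<lambda>q. (f q, \<nu> q)) p"
    using front unfolding front_def by (elim conjE)
  from spec[OF this, of p, unfolded immersion_at_def, THEN bspec, OF c(1)]
  have "inj (push (U, \<phi>) (\<lambda>q. (f q, \<nu> q)) p)"
    using c(2) by simp
  from injD[OF this eq] have "K (axis 1 1) = 0" .
  then show False
    using JK[of "axis 1 1"] linear_0[OF lin] by (simp add: axis_eq_0_iff)
qed

text \<open>Otherwise \<open>n1 0\<close> would be orthogonal to both \<open>a 0\<close> and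
  \<open>b 0\<close>, hence a multiple of \<open>\<nu> p\<close>; being orthogonal to that unit
  vector too, it would be zero.\<close>

lemma a_n1: "a 0 \<bullet> n1 0 \<noteq> 0"
proof
  assume "a 0 \<bullet> n1 0 = 0"
  have "norm (\<nu> p) = 1" using front by (simp add: front_def)
  moreover have "b 0 \<bullet> \<nu> p = 0" using b_tangent[OF p(1)] p(2) by simp
  ultimately have "n1 0 = (n1 0 \<bullet> \<nu> p) *\<^sub>R \<nu> p"
    using orthogonal_to_plane_eq[OF independent[OF zero_in_image]] a_tangent
      \<open>a 0 \<bullet> n1 0 = 0\<close> b_n1 by blast
  then show False using n1_tangent n1_nonzero by simp
qed

text \<open>Through \<open>J\<close> the second fundamental form at \<open>p\<close> becomes -(JX)_2
  (JY)_2 (b.n2): u = 0 removes the \<open>a\<close> terms and \<open>b_n1\<close> the mixed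
  one.\<close>

lemma generic_iff: "generic A f \<nu> p \<longleftrightarrow> b 0 \<bullet> n2 0 \<noteq> 0"
proof
  assume "generic A f \<nu> p"
  then obtain U \<phi> X Y where c: "(U, \<phi>) \<in> A" "p \<in> U"
    and h: "second_fundamental_form (U, \<phi>) f \<nu> p X Y \<noteq> 0"
    unfolding generic_def by (metis fst_conv surj_pair)
  obtain J K :: "real^2 \<Rightarrow> real^2" where 
    push: "\<And>X. push (U, \<phi>) f p X = (J X $ 1 * \<alpha> p $ 1) *\<^sub>R a (\<alpha> p) + J X $ 2 *\<^sub>R b (\<alpha> p)"
      "\<And>X. push (U, \<phi>) \<nu> p X = J X $ 1 *\<^sub>R n1 (\<alpha> p) + J X $ 2 *\<^sub>R n2 (\<alpha> p)"
    by (rule chart_derivatives[OF c p(1)]) blast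
  show "b 0 \<bullet> n2 0 \<noteq> 0"
    using h unfolding second_fundamental_form_def push p
    by (auto simp: inner_add_right b_n1)
next
  assume ne: "b 0 \<bullet> n2 0 \<noteq> 0"
  obtain U \<phi> where c: "(U, \<phi>) \<in> A" "p \<in> U" by (rule oriented_atlas_cover[OF atlas])
  obtain J K :: "real^2 \<Rightarrow> real^2" where JK: "\<And>X. J (K X) = X" and
    push: "\<And>X. push (U, \<phi>) f p X = (J X $ 1 * \<alpha> p $ 1) *\<^sub>R a (\<alpha> p) + J X $ 2 *\<^sub>R b (\<alpha> p)"
      "\<And>X. push (U, \<phi>) \<nu> p X = J X $ 1 *\<^sub>R n1 (\<alpha> p) + J X $ 2 *\<^sub>R n2 (\<alpha> p)"
    by (rule chart_derivatives[OF c p(1)]) blast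
  have "second_fundamental_form (U, \<phi>) f \<nu> p (K (axis 2 1)) (K (axis 2 1)) \<noteq> 0"
    unfolding second_fundamental_form_def push p JK using ne by (simp add: axis_def)
  then show "generic A f \<nu> p"
    unfolding generic_def using c by force
qed

section \<open>Growth and sign of the curvature\<close>

definition scaled_curvature :: "real^2 \<Rightarrow> real" where
  "scaled_curvature y = (cross3 (a y) (b y) \<bullet> cross3 (n1 y) (n2 y)) / (norm (cross3 (a y) (b y)))\<^sup>2"

lemma gaussian_curvature_scaled:
  "q \<in> V \<Longrightarrow> \<alpha> q $ 1 \<noteq> 0 \<Longrightarrow> gaussian_curvature A f q = scaled_curvature (\<alpha> q) / \<alpha> q $ 1"
  using gaussian_curvature_eq by (simp add: scaled_curvature_def)

text \<open>At the origin the numerator reduces to (a.n1)(b.n2) because b.n1 = 0; both factors are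
  nonzero, and continuity spreads the sign and a lower bound over a disc.\<close>

lemma scaled_curvature_bounded_away:
  assumes "generic A f \<nu> p"
  obtains r k where "r > 0" "k \<noteq> 0" "ball 0 r \<subseteq> \<alpha> ` V"
    "\<And>y. y \<in> ball 0 r \<Longrightarrow> \<bar>k\<bar> \<le> \<bar>scaled_curvature y\<bar> \<and> k * scaled_curvature y > 0"
proof -
  let ?D = scaled_curvature
  have op: "open (\<alpha> ` V)" using open_embeddingD(2)[OF embedding] .
  have contD: "continuous_on (\<alpha> ` V) ?D"
    unfolding scaled_curvature_def
    using independent
    by (intro continuous_on_divide continuous_on_inner continuous_on_power continuous_on_norm
        continuous_on_cross continuous_frame) auto
  have cont: "isCont ?D 0"
    using contD zero_in_image unfolding continuous_on_eq_continuous_at[OF op] by blast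
  have D0: "?D 0 \<noteq> 0"
    using assms independent[OF zero_in_image] a_n1
    by (simp add: scaled_curvature_def dot_cross generic_iff b_n1 inner_commute)
  \<comment> \<open>Half the value at the origin: a number at distance less than |k| from 2k has the
    sign of k and modulus above |k|.\<close>
  define k where "k = ?D 0 / 2"
  have "\<forall>\<^sub>F y in nhds 0. dist (?D y) (?D 0) < \<bar>k\<bar>"
    using cont D0 unfolding isCont_def tendsto_iff k_def
    by (auto simp: eventually_at_filter elim!: allE[of _ "\<bar>?D 0 / 2\<bar>"] eventually_mono)
  moreover have "\<forall>\<^sub>F y in nhds 0. y \<in> \<alpha> ` V"
    using op zero_in_image by (simp add: eventually_nhds_in_open)
  ultimately have "\<forall>\<^sub>F y in nhds 0. dist (?D y) (?D 0) < \<bar>k\<bar> \<and> y \<in> \<alpha> ` V"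
    by (rule eventually_conj)
  then obtain r where r: "r > 0" "\<And>y. dist y 0 < r \<Longrightarrow> dist (?D y) (?D 0) < \<bar>k\<bar> \<and> y \<in> \<alpha> ` V"
    unfolding eventually_nhds_metric by auto
  show thesis
  proof (rule that)
    show "r > 0" by fact
    show "k \<noteq> 0" using D0 by (simp add: k_def)
    show "ball 0 r \<subseteq> \<alpha> ` V" using r by (auto simp: dist_commute)
    fix y :: "real^2" assume "y \<in> ball 0 r"
    then have "\<bar>?D y - 2 * k\<bar> < \<bar>k\<bar>"
      using r(2)[of y] by (simp add: dist_real_def k_def)
    then have "k > 0 \<and> ?D y > k \<or> k < 0 \<and> ?D y < k"
      by (auto simp: abs_if split: if_splits)
    then show "\<bar>k\<bar> \<le> \<bar>?D y\<bar> \<and> k * ?D y > 0"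
      by (auto simp: mult_neg_neg)
  qed
qed

lemma curvature_unbounded:
  assumes "generic A f \<nu> p"
  shows "curvature_unbounded_near A f p"
  unfolding curvature_unbounded_near_def
proof (intro allI impI notI)
  fix W assume W: "open W \<and> p \<in> W" and "bounded (gaussian_curvature A f ` (W - singular_set A f))"
  then obtain M where M: "M > 0" "\<And>q. q \<in> W - singular_set A f \<Longrightarrow> \<bar>gaussian_curvature A f q\<bar> \<le> M"
    unfolding bounded_pos by auto
  obtain r k where r: "r > 0" "k \<noteq> 0"
    "\<And>y. y \<in> ball 0 r \<Longrightarrow> \<bar>k\<bar> \<le> \<bar>scaled_curvature y\<bar> \<and> k * scaled_curvature y > 0"
    by (rule scaled_curvature_bounded_away[OF assms]) blast
  have "open (\<alpha> ` (V \<inter> W))" "0 \<in> \<alpha> ` (V \<inter> W)"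
    using open_embedding_image_open[OF embedding] W p by force+
  then obtain r' where r': "r' > 0" "ball 0 r' \<subseteq> \<alpha> ` (V \<inter> W)"
    unfolding open_contains_ball by blast
  \<comment> \<open>The point (s, 0) must lie in both discs and satisfy |k|/s > M, since the
    curvature there is at least |k|/s in modulus; the halves make all inequalities strict.\<close>
  define s where "s = min (min r r' / 2) (\<bar>k\<bar> / (2 * M))"
  have s: "s > 0" "s < r" "s < r'" "s * M < \<bar>k\<bar>"
  proof -
    show "s > 0" "s < r" "s < r'" using r r' M by (auto simp: s_def)
    have "s \<le> \<bar>k\<bar> / (2 * M)" by (simp add: s_def)
    then have "s * M \<le> \<bar>k\<bar> / 2" using M(1) by (simp add: field_simps)
    then show "s * M < \<bar>k\<bar>" using r(2) by linarith
  qed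
  define y :: "real^2" where "y = s *\<^sub>R axis 1 1"
  have y: "y \<in> ball 0 r" "y \<in> ball 0 r'" using s by (auto simp: y_def)
  with r' obtain q where q: "q \<in> V" "q \<in> W" "\<alpha> q = y" by blast
  have y1: "y $ 1 = s" by (simp add: y_def axis_def)
  have "q \<notin> singular_set A f" using singular_iff[OF q(1)] q(3) y1 s by simp
  with M(2) q have "\<bar>gaussian_curvature A f q\<bar> \<le> M" by simp
  then have "\<bar>scaled_curvature y\<bar> \<le> s * M"
    using gaussian_curvature_scaled[OF q(1)] q(3) y1 s(1) by (simp add: abs_divide field_simps)
  moreover have "\<bar>k\<bar> \<le> \<bar>scaled_curvature y\<bar>" using r(3) y(1) by blast
  ultimately show False using s(4) by linarith
qed

text \<open>Only the sign of \<open>k\<close> matters. When it is the sign of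
  \<open>scaled_curvature\<close>, the curvature is positive on \<open>side r k\<close> and negative
  on \<open>side r (- k)\<close>.\<close>

definition side :: "real \<Rightarrow> real \<Rightarrow> 'm set" where
  "side r k = V \<inter> \<alpha> -` (ball 0 r \<inter> {y. k * y $ 1 > 0})"

lemma half_plane_eq: "{y :: real^2. k * y $ 1 > 0} = {y. (k *\<^sub>R axis 1 1) \<bullet> y > 0}"
  by (simp add: inner_axis')

lemma open_side: "open (side r k)"
  unfolding side_def half_plane_eq
  by (intro open_embedding_preimage_open[OF embedding] open_Int open_ball open_halfspace_gt)

text \<open>A half-disc is convex, and the side is its image under the continuous inverse of the
  coordinates.\<close>

lemma connected_side:
  assumes "ball 0 r \<subseteq> \<alpha> ` V"
  shows "connected (side r k)"
proof -
  let ?H = "ball 0 r \<inter> {y::real^2. k * y $ 1 > 0}"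
  have "side r k = inv_into V \<alpha> ` ?H"
  proof (intro set_eqI iffI)
    fix q assume "q \<in> side r k"
    then show "q \<in> inv_into V \<alpha> ` ?H"
      using inverse_coordinates by (force simp: side_def)
  next
    fix q assume "q \<in> inv_into V \<alpha> ` ?H"
    then obtain y where y: "y \<in> ?H" "q = inv_into V \<alpha> y" by blast
    then have "y \<in> \<alpha> ` V" using assms by blast
    then show "q \<in> side r k"
      using y by (simp add: side_def inv_into_into f_inv_into_f)
  qed
  moreover have "convex ?H"
    unfolding half_plane_eq by (intro convex_Int convex_ball convex_halfspace_gt)
  moreover have "continuous_on ?H (inv_into V \<alpha>)"
    using open_embeddingD(5)[OF embedding] by (rule continuous_on_subset) (use assms in auto)
  ultimately show ?thesis
    by (simp add: connected_continuous_image convex_connected)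
qed

text \<open>A small displacement in the u-direction with the sign of \<open>k\<close> moves a
  singular point into the chosen half-disc while staying in any given neighbourhood.\<close>

lemma closure_side:
  assumes "q \<in> V" "\<alpha> q \<in> ball 0 r" "\<alpha> q $ 1 = 0" "k \<noteq> 0"
  shows "q \<in> closure (side r k)"
  unfolding closure_iff_nhds_not_empty
proof (intro allI impI)
  fix B W assume W: "W \<subseteq> B" "q \<in> W" "open W"
  let ?O = "\<alpha> ` (V \<inter> (W \<inter> (V \<inter> \<alpha> -` ball 0 r)))"
  have "open ?O"
    by (intro open_embedding_image_open[OF embedding] open_Int W(3)
        open_embedding_preimage_open[OF embedding] open_ball)
  moreover have "\<alpha> q \<in> ?O" using assms W by auto
  ultimately obtain d where d: "d > 0" "ball (\<alpha> q) d \<subseteq> ?O"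
    unfolding open_contains_ball by blast
  define y where "y = \<alpha> q + (sgn k * d / 2) *\<^sub>R axis 1 1"
  have "y \<in> ball (\<alpha> q) d" using d(1) assms(4) by (simp add: y_def dist_norm abs_mult abs_sgn_eq)
  with d obtain q' where q': "q' \<in> V" "q' \<in> W" "\<alpha> q' = y" "y \<in> ball 0 r" by blast
  have "k * y $ 1 = \<bar>k\<bar> * d / 2"
    using assms(3) by (simp add: y_def axis_def abs_sgn[of k])
  also have "\<dots> > 0" using d(1) assms(4) by simp
  finally have "k * y $ 1 > 0" .
  with q' W have "q' \<in> side r k \<inter> B" by (auto simp: side_def)
  then show "side r k \<inter> B \<noteq> {}" by blast
qed

lemma curvature_changes_sign:
  assumes "generic A f \<nu> p"
  shows "curvature_changes_sign_across A f p"
proof -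
  obtain r k where r: "r > 0" "k \<noteq> 0" "ball 0 r \<subseteq> \<alpha> ` V"
    and D: "\<And>y. y \<in> ball 0 r \<Longrightarrow> \<bar>k\<bar> \<le> \<bar>scaled_curvature y\<bar> \<and> k * scaled_curvature y > 0"
    by (rule scaled_curvature_bounded_away[OF assms]) (rule that)
  let ?U = "V \<inter> \<alpha> -` ball 0 r"
  have U: "open ?U" by (intro open_embedding_preimage_open[OF embedding] open_ball)
  have pU: "p \<in> ?U" using p r(1) by simp
  have disjoint: "side r k \<inter> side r (- k) = {}" by (auto simp: side_def)
  have regular: "?U - singular_set A f = side r k \<union> side r (- k)"
    using singular_iff r(2) by (auto simp: side_def zero_less_mult_iff mult_less_0_iff)
  have singular: "?U \<inter> singular_set A f \<subseteq> closure (side r k) \<inter> closure (side r (- k))"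
    using closure_side[of _ r k] closure_side[of _ r "- k"] singular_iff r(2) by auto
  have pos: "gaussian_curvature A f q > 0" if "q \<in> side r k" for q
  proof -
    have q: "q \<in> V" "\<alpha> q \<in> ball 0 r" "k * \<alpha> q $ 1 > 0" using that by (auto simp: side_def)
    then show ?thesis
      using gaussian_curvature_scaled[OF q(1)] D[OF q(2)]
      by (auto simp: zero_less_mult_iff zero_less_divide_iff)
  qed
  have neg: "gaussian_curvature A f q < 0" if "q \<in> side r (- k)" for q
  proof -
    have q: "q \<in> V" "\<alpha> q \<in> ball 0 r" "k * \<alpha> q $ 1 < 0" using that by (auto simp: side_def)
    then show ?thesis
      using gaussian_curvature_scaled[OF q(1)] D[OF q(2)]
      by (auto simp: zero_less_mult_iff mult_less_0_iff divide_less_0_iff)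
  qed
  show ?thesis
    unfolding curvature_changes_sign_across_def
    by (intro exI[of _ ?U] exI[of _ "side r k"] exI[of _ "side r (- k)"] conjI ballI
        U pU open_side connected_side[OF r(3)] disjoint regular singular pos neg)
qed

end

section \<open>The osculating plane of the singular curve\<close>

text \<open>The span lies in the hyperplane, and both have dimension 2.\<close>

lemma hyperplane_eq_span:
  fixes n v w :: "real^3"
  assumes "n \<noteq> 0" "v \<bullet> n = 0" "w \<bullet> n = 0" "\<not> collinear {0, v, w}"
  shows "{x. x \<bullet> n = 0} = span {v, w}"
proof -
  have ne: "v \<noteq> 0" "w \<noteq> 0" "\<And>c. w \<noteq> c *\<^sub>R v"
    using assms(4) by (auto simp: collinear_lemma)
  then have "w \<notin> span {v}" by (auto simp: span_singleton)
  with ne(1) have "independent {w, v}" by (simp add: independent_insert)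
  then have "independent {v, w}" by (metis insert_commute)
  moreover have "v \<noteq> w" using ne(3)[of 1] by auto
  ultimately have dim: "dim (span {v, w}) = 2"
    by (simp add: dim_eq_card_independent)
  have dim': "dim {x. x \<bullet> n = 0} = 2"
    using dim_hyperplane[OF assms(1)] by (simp add: inner_commute)
  have sub: "subspace {x. x \<bullet> n = 0}"
    using subspace_hyperplane[of n] by (simp add: inner_commute)
  have "span {v, w} \<subseteq> {x. x \<bullet> n = 0}"
    using assms(2,3) by (intro span_minimal sub) auto
  then have "span {v, w} = {x. x \<bullet> n = 0}"
    by (rule subspace_dim_equal[OF subspace_span sub]) (simp only: dim dim')
  then show ?thesis by simp
qed

text \<open>If c' and c'' are collinear, c'' is a multiple of the nonzero c', hence orthogonal to
  \<open>n\<close>, which agrees with the convention that the plane is then \<open>P\<close>. If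
  they are independent, their span is the plane orthogonal to \<open>n\<close> exactly when c'' is
  orthogonal to \<open>n\<close>.\<close>

lemma osculating_plane_ne_iff:
  fixes c :: "real \<Rightarrow> real^3" and t :: real and n :: "real^3"
  defines "c1 \<equiv> vector_derivative c (at t)"
    and "c2 \<equiv> vector_derivative (\<lambda>s. vector_derivative c (at s)) (at t)"
    and "P \<equiv> {x. (x - c t) \<bullet> n = 0}"
  assumes "n \<noteq> 0" "c1 \<noteq> 0" "c1 \<bullet> n = 0"
  shows "osculating_plane c t P \<noteq> P \<longleftrightarrow> c2 \<bullet> n \<noteq> 0"
proof (cases "collinear {0, c1, c2}")
  case True
  then have "c2 \<bullet> n = 0"
    using assms(5,6) by (auto simp: collinear_lemma)
  then show ?thesis
    using True by (simp add: osculating_plane_def c1_def[symmetric] c2_def[symmetric])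
next
  case False
  then have osc: "osculating_plane c t P = (+) (c t) ` span {c1, c2}"
    by (simp add: osculating_plane_def c1_def[symmetric] c2_def[symmetric])
  show ?thesis
  proof (cases "c2 \<bullet> n = 0")
    case True
    have "P = (+) (c t) ` {x. x \<bullet> n = 0}"
    proof (intro set_eqI iffI)
      fix x assume "x \<in> P"
      then show "x \<in> (+) (c t) ` {x. x \<bullet> n = 0}"
        by (intro image_eqI[of _ _ "x - c t"]) (auto simp: P_def)
    qed (auto simp: P_def)
    then show ?thesis
      using hyperplane_eq_span[OF assms(4,6) True False] osc True by simp
  next
    case ne: False
    \<comment> \<open>A witness for the difference of the two planes.\<close>
    have "c t + c2 \<in> osculating_plane c t P"
      unfolding osc by (intro imageI span_base) simp
    moreover have "c t + c2 \<notin> P" using ne by (simp add: P_def)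
    ultimately show ?thesis using ne by metis
  qed
qed

context cuspidal_coordinates
begin

text \<open>The acceleration is formed in an atlas chart, where \<open>f\<close> and the curve are
  smooth; the adapted coordinates enter only through the velocity at \<open>p\<close>, which is (0,
  v) there with v nonzero. So the space curve has velocity v b, and its normal acceleration is -v^2
  (b.n2).\<close>

lemma singular_curve_osculating_iff:
  assumes curve: "singular_curve A f p \<gamma> t"
  shows "osculating_plane (f \<circ> \<gamma>) t (limiting_tangent_plane f \<nu> p) \<noteq> limiting_tangent_plane f \<nu> p
    \<longleftrightarrow> b 0 \<bullet> n2 0 \<noteq> 0"
proof -
  obtain e W where \<gamma>t: "\<gamma> t = p" and e: "e > 0" and reg: "regular_curve A {t-e<..<t+e} \<gamma>"
    and W: "W \<inter> singular_set A f = \<gamma> ` {t-e<..<t+e}"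
    using curve unfolding singular_curve_def by blast
  define I where "I = {t-e<..<t+e}"
  obtain U \<phi> where c: "(U, \<phi>) \<in> A" "p \<in> U" by (rule oriented_atlas_cover[OF atlas])
  note emb = oriented_atlas_chart[OF atlas c(1)]
  have I: "open I" "t \<in> I" and cont: "continuous_on I \<gamma>"
    using reg e by (auto simp: I_def regular_curve_def)
  define T where "T = I \<inter> \<gamma> -` U"
  have T: "open T" "t \<in> T"
    using continuous_open_preimage[OF cont I(1) open_embeddingD(1)[OF emb]] I c \<gamma>t by (auto simp: T_def)
  define F where "F = f \<circ> inv_into U \<phi>"
  define N where "N = \<nu> \<circ> inv_into U \<phi>"
  have F: "smooth_on (\<phi> ` U) F" and N: "smooth_on (\<phi> ` U) N"
    using front c by (auto simp: front_def smooth_map_def F_def N_def)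
  define x where "x = \<phi> \<circ> \<gamma>"
  define x' where "x' s = frechet_derivative x (at s) 1" for s
  have "{s \<in> I. \<gamma> s \<in> U} = T" by (auto simp: T_def)
  moreover have "smooth_on {s \<in> I. \<gamma> s \<in> U} x \<and> (\<forall>s\<in>I. \<gamma> s \<in> U \<longrightarrow> vector_derivative x (at s) \<noteq> 0)"
    using reg bspec[OF _ c(1), of "\<lambda>(U, \<phi>). smooth_on {s \<in> I. \<gamma> s \<in> U} (\<phi> \<circ> \<gamma>) \<and>
        (\<forall>s\<in>I. \<gamma> s \<in> U \<longrightarrow> vector_derivative (\<phi> \<circ> \<gamma>) (at s) \<noteq> 0)"]
    unfolding regular_curve_def I_def[symmetric] x_def by simp
  ultimately have smooth_x: "smooth_on T x" and ne: "vector_derivative x (at t) \<noteq> 0"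
    using c(2) \<gamma>t I(2) by simp_all
  have x_deriv: "(x has_vector_derivative x' s) (at s)" if "s \<in> T" for s
  proof -
    note d = smooth_on_has_derivative[OF smooth_x that]
    have "frechet_derivative x (at s) = (\<lambda>h. h *\<^sub>R x' s)"
    proof
      show "frechet_derivative x (at s) h = h *\<^sub>R x' s" for h
        using linear_scale[OF has_derivative_linear[OF d], of h 1] by (simp only: x'_def real_scaleR_def mult_1_right)
    qed
    with d show ?thesis by (simp only: has_vector_derivative_def)
  qed
  have x'_ne: "x' t \<noteq> 0"
    using ne vector_derivative_at[OF x_deriv[OF T(2)]] by simp
  have x_in: "x s \<in> \<phi> ` U" if "s \<in> T" for s
    using that by (auto simp: T_def x_def)
  \<comment> \<open>In this form the velocity of the space curve is visibly differentiable in
    \<open>s\<close>; \<open>y_push\<close> identifies it with a push-forward.\<close>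
  define y where "y s = x' s $ 1 *\<^sub>R partial 1 F (x s) + x' s $ 2 *\<^sub>R partial 2 F (x s)" for s
  have y_push: "y s = push (U, \<phi>) f (\<gamma> s) (x' s)" if "s \<in> T" for s
    using linear_on_real2[OF linear_frechet_derivative[OF smooth_on_differentiable[OF F x_in[OF that]]], of "x' s"]
    by (simp add: y_def partial_def push_def F_def x_def)
  have chain: "((\<lambda>s. g (\<gamma> s)) has_vector_derivative push (U, \<phi>) g (\<gamma> s) (x' s)) (at s)"
    if s: "s \<in> T" and g: "smooth_on (\<phi> ` U) (g \<circ> inv_into U \<phi>)" for s and g :: "'m \<Rightarrow> real^3"
  proof -
    let ?G = "g \<circ> inv_into U \<phi>"
    have "(?G \<circ> x has_vector_derivative frechet_derivative ?G (at (x s)) (x' s)) (at s)"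
      by (rule vector_derivative_diff_chain_within[OF x_deriv[OF s]])
        (use smooth_on_has_derivative[OF g x_in[OF s]] has_derivative_at_withinI in blast)
    then have "((\<lambda>s. g (\<gamma> s)) has_vector_derivative frechet_derivative ?G (at (x s)) (x' s)) (at s)"
      by (rule has_vector_derivative_transform_within_open[OF _ T(1) s])
        (use open_embeddingD(6)[OF emb] in \<open>auto simp: T_def x_def\<close>)
    then show ?thesis
      by (simp add: push_def x_def)
  qed
  have f_deriv: "(f \<circ> \<gamma> has_vector_derivative y s) (at s)" if "s \<in> T" for s
    using chain[OF that F[unfolded F_def]] y_push[OF that] by (simp add: o_def)
  have "y differentiable (at t)"
  proof -
    have x'd: "x' differentiable (at t)"
      unfolding x'_def[abs_def]
      by (rule smooth_on_differentiable[OF smooth_on_frechet_derivative[OF smooth_x] T(2)])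
    have comp: "(\<lambda>s. x' s $ i) differentiable (at t)" for i
      using x'd bounded_linear.has_derivative[OF bounded_linear_vec_nth[of i]]
      unfolding differentiable_def by blast
    have part: "(\<lambda>s. partial i F (x s)) differentiable (at t)" for i
      using differentiable_chain_at[OF smooth_on_differentiable[OF smooth_x T(2)]
          smooth_on_differentiable[OF smooth_on_partial[OF F] x_in[OF T(2)]], of i]
      by (simp add: o_def)
    show ?thesis
      unfolding y_def[abs_def]
      by (intro differentiable_add differentiable_scaleR comp part)
  qed
  then obtain z where z: "(y has_vector_derivative z) (at t)"
    using vector_derivative_works by blast
  have c1: "vector_derivative (f \<circ> \<gamma>) (at s) = y s" if "s \<in> T" for s
    using vector_derivative_at[OF f_deriv[OF that]] .
  have c2: "vector_derivative (\<lambda>s. vector_derivative (f \<circ> \<gamma>) (at s)) (at t) = z"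
    by (rule vector_derivative_at, rule has_vector_derivative_transform_within_open[OF z T]) (simp add: c1)
  obtain J K :: "real^2 \<Rightarrow> real^2" where J: "((\<alpha> \<circ> inv_into U \<phi>) has_derivative J) (at (\<phi> p))"
    and lin: "linear K" and KJ: "\<And>X. K (J X) = X"
    and push: "\<And>X. push (U, \<phi>) f p X = (J X $ 1 * \<alpha> p $ 1) *\<^sub>R a (\<alpha> p) + J X $ 2 *\<^sub>R b (\<alpha> p)"
      "\<And>X. push (U, \<phi>) \<nu> p X = J X $ 1 *\<^sub>R n1 (\<alpha> p) + J X $ 2 *\<^sub>R n2 (\<alpha> p)"
    by (rule chart_derivatives[OF c p(1)]) blast
  define v where "v = J (x' t) $ 2"
  \<comment> \<open>The curve stays in the singular set, where the first adapted coordinate vanishes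
    identically, so its derivative is zero.\<close>
  have J1: "J (x' t) $ 1 = 0"
  proof -
    define S where "S = I \<inter> \<gamma> -` (U \<inter> V)"
    have S: "open S" "t \<in> S"
      using continuous_open_preimage[OF cont I(1) open_Int[OF open_embeddingD(1)[OF emb] open_embeddingD(1)[OF embedding]]]
        I c \<gamma>t p by (auto simp: S_def)
    have x_t: "x t = \<phi> p" by (simp add: x_def \<gamma>t)
    have "((\<alpha> \<circ> inv_into U \<phi>) \<circ> x has_vector_derivative J (x' t)) (at t)"
      by (rule vector_derivative_diff_chain_within[OF x_deriv[OF T(2)]])
        (simp only: x_t has_derivative_at_withinI[OF J])
    then have d1: "((\<lambda>s. ((\<alpha> \<circ> inv_into U \<phi>) \<circ> x) s $ 1) has_vector_derivative J (x' t) $ 1) (at t)"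
      by (rule bounded_linear.has_vector_derivative[OF bounded_linear_vec_nth])
    have "0 = ((\<alpha> \<circ> inv_into U \<phi>) \<circ> x) s $ 1" if "s \<in> S" for s
    proof -
      have "\<gamma> s \<in> singular_set A f" "\<gamma> s \<in> V" "\<gamma> s \<in> U"
        using that W by (auto simp: S_def I_def)
      then show ?thesis
        using singular_iff open_embeddingD(6)[OF emb] by (simp add: x_def)
    qed
    then have "((\<lambda>s. ((\<alpha> \<circ> inv_into U \<phi>) \<circ> x) s $ 1) has_vector_derivative 0) (at t)"
      by (rule has_vector_derivative_transform_within_open[OF has_vector_derivative_const S])
    from vector_derivative_unique_at[OF d1 this] show ?thesis .
  qed
  \<comment> \<open>\<open>J\<close> is injective and the curve is regular, so the remaining
    component of the velocity cannot vanish.\<close>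
  have v: "v \<noteq> 0"
  proof
    assume "v = 0"
    with J1 have "J (x' t) = 0" by (simp add: v_def vec_eq_iff forall_2)
    with KJ[of "x' t"] linear_0[OF lin] x'_ne show False by simp
  qed
  have b: "b 0 \<bullet> \<nu> p = 0" "b 0 \<noteq> 0"
    using b_tangent[OF p(1)] p(2) independent[OF zero_in_image] by auto
  have y_t: "y t = v *\<^sub>R b 0"
    using y_push[OF T(2)] \<gamma>t J1 p by (simp add: push v_def)
  have "((\<lambda>s. \<nu> (\<gamma> s)) has_vector_derivative v *\<^sub>R n2 0) (at t)"
    using chain[OF T(2) N[unfolded N_def]] \<gamma>t J1 p by (simp add: push v_def)
  from has_derivative_inner[OF z[unfolded has_vector_derivative_def] this[unfolded has_vector_derivative_def]]
  have "((\<lambda>s. y s \<bullet> \<nu> (\<gamma> s)) has_derivative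
      (\<lambda>h. y t \<bullet> (h *\<^sub>R v *\<^sub>R n2 0) + h *\<^sub>R z \<bullet> \<nu> (\<gamma> t))) (at t)" .
  moreover have "((\<lambda>s. y s \<bullet> \<nu> (\<gamma> s)) has_derivative (\<lambda>h. 0)) (at t)"
  proof (rule has_derivative_transform_within_open[OF has_derivative_const[of 0] T])
    fix s assume s: "s \<in> T"
    then have "push (U, \<phi>) f (\<gamma> s) (x' s) \<bullet> \<nu> (\<gamma> s) = 0"
      using front c(1) unfolding front_def T_def by fastforce
    then show "0 = y s \<bullet> \<nu> (\<gamma> s)" using y_push[OF s] by simp
  qed
  ultimately have "(\<lambda>h. y t \<bullet> (h *\<^sub>R v *\<^sub>R n2 0) + h *\<^sub>R z \<bullet> \<nu> (\<gamma> t)) = (\<lambda>h. 0)"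
    by (rule has_derivative_unique)
  from fun_cong[OF this, of 1] have "z \<bullet> \<nu> p = - v\<^sup>2 * (b 0 \<bullet> n2 0)"
    by (simp add: y_t \<gamma>t power2_eq_square)
  then have "z \<bullet> \<nu> p \<noteq> 0 \<longleftrightarrow> b 0 \<bullet> n2 0 \<noteq> 0"
    using v by simp
  moreover have "\<nu> p \<noteq> 0"
    using front unfolding front_def by (metis norm_zero zero_neq_one)
  ultimately show ?thesis
    using osculating_plane_ne_iff[of "\<nu> p" "f \<circ> \<gamma>" t] c1[OF T(2)] c2 y_t v b \<gamma>t
    by (simp add: limiting_tangent_plane_def)
qed

end

theorem corollary3p6:
  fixes A :: "'m::{t2_space,second_countable_topology} chart set"
    and f \<nu> :: "'m \<Rightarrow> real^3" and p :: 'm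
  assumes "oriented_atlas A" and "front A f \<nu>" and "cuspidal_edge A f p"
  shows "(\<forall>\<gamma> t. singular_curve A f p \<gamma> t \<longrightarrow>
            (generic A f \<nu> p \<longleftrightarrow>
             osculating_plane (f \<circ> \<gamma>) t (limiting_tangent_plane f \<nu> p)
               \<noteq> limiting_tangent_plane f \<nu> p))
       \<and> (generic A f \<nu> p \<longrightarrow>
            curvature_unbounded_near A f p \<and> curvature_changes_sign_across A f p)"
proof -
  obtain V \<alpha> a b n1 n2 where "cuspidal_coordinates A f \<nu> p V \<alpha> a b n1 n2"
    using cuspidal_coordinates_exist[OF assms] by blast
  then interpret cuspidal_coordinates A f \<nu> p V \<alpha> a b n1 n2 .
  show ?thesis
    using generic_iff singular_curve_osculating_iff curvature_unbounded curvature_changes_sign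
    by blast
qed

end
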